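(* Let $\lambda$ be a strict partition of $n$ and let $\alpha=(\alpha_1,\alpha_2,\ldots)$ be a composition of $n$. Then there exists a bijection between the set of marked shifted $\lambda$-tableaux of weight $\alpha$ and the set of colored shifted $\lambda$-tableaux of weight $\alpha$.
   Context: A composition of $n$ is a sequence $(\alpha_1,\alpha_2,\ldots)$ of nonnegative integers with sum $n$. For a strict partition $\lambda=(\lambda_1>\cdots>\lambda_\ell>0)$, the shifted diagram is $\lambda^*=\{(i,j): 1\le i\le\ell,\ i\le j\le\lambda_i+i-1\}$ ($i$ the row index, $j$ the column index). Let $\mathbf{P}'$ be the ordered alphabet $\{1'<1<2'<2<3'<3<\cdots\}$; the symbols $1',2',3',\ldots$ are called marked, the symbols $1,2,3,\dots$ unmarked, and $|k'|=|k|=k$. A marked shifted $\lambda$-tableau is a map $T:\lambda^*\to\mathbf{P}'$ such that: (M1) the letters weakly increase along each row and each column; (M2) the letters $\{1,2,3,\ldots\}$ are strictly increasing along each column (each unmarked letter occurs at most once in each column); (M3) the letters $\{1',2',3',\ldots\}$ are strictly increasing along each row (each marked letter occurs at most once in each row). A shifted reverse plane tableau of shape $\lambda$ is a labelling of the cells of $\lambda^*$ by nonnegative integers which is weakly increasing along rows and columns. A colored shifted $\lambda$-tableau is a map $C:\lambda^*\to\mathbf{P}'$ such that the map $\overline C$ on $\lambda^*$ defined by $\overline C(i,j)=|C(i,j)|-j$ if $C(i,j)$ is marked and $\overline C(i,j)=|C(i,j)|-i$ if $C(i,j)$ is unmarked takes nonnegative integer values and is a shifted reverse plane tableau of shape $\lambda$.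 The weight of a map $T:\lambda^*\to\mathbf{P}'$ is the sequence $(\alpha_1,\alpha_2,\ldots)$ where $\alpha_k$ is the number of cells $(i,j)\in\lambda^*$ with $|T(i,j)|=k$. *)

theory Defs
  imports "HOL-Library.FuncSet"
begin

definition strict_partition :: "nat list \<Rightarrow> nat \<Rightarrow> bool" where
  "strict_partition lam n \<longleftrightarrow>
     sorted_wrt (>) lam \<and> (\<forall>x \<in> set lam. 0 < x) \<and> sum_list lam = n"

text \<open>Compositions are infinite sequences \<open>\<alpha>\<^sub>1, \<alpha>\<^sub>2, \<dots>\<close>; the value at index 0 is not part of the data.
  Finite support is required explicitly since \<open>sum\<close> over an infinite set is 0.\<close>

definition composition :: "(nat \<Rightarrow> nat) \<Rightarrow> nat \<Rightarrow> bool" where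
  "composition \<alpha> n \<longleftrightarrow>
     finite {k. 1 \<le> k \<and> \<alpha> k \<noteq> 0} \<and> (\<Sum>k | 1 \<le> k \<and> \<alpha> k \<noteq> 0. \<alpha> k) = n"

text \<open>Cells are 1-based, whereas list positions are 0-based.\<close>

definition shifted_diagram :: "nat list \<Rightarrow> (nat \<times> nat) set" where
  "shifted_diagram lam =
     {(i, j). 1 \<le> i \<and> i \<le> length lam \<and> i \<le> j \<and> j \<le> lam ! (i - 1) + i - 1}"

text \<open>The type also contains the letters of index 0; \<open>alphabet\<close> below excludes them.\<close>

datatype letter = is_marked: Marked (letter_abs: nat) | Unmarked (letter_abs: nat)

definition alphabet :: "letter set" where
  "alphabet = {x. 1 \<le> letter_abs x}"

text \<open>The order \<open>1' < 1 < 2' < 2 < \<dots>\<close>\<close>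

instantiation letter :: linorder
begin

definition less_letter :: "letter \<Rightarrow> letter \<Rightarrow> bool" where
  "x < y \<longleftrightarrow> letter_abs x < letter_abs y \<or>
     (letter_abs x = letter_abs y \<and> is_marked x \<and> \<not> is_marked y)"

definition less_eq_letter :: "letter \<Rightarrow> letter \<Rightarrow> bool" where
  "x \<le> y \<longleftrightarrow> x < y \<or> x = (y :: letter)"

instance
proof
  fix x y z :: letter
  show "(x < y) = (x \<le> y \<and> \<not> y \<le> x)"
    by (auto simp: less_eq_letter_def less_letter_def)
  show "x \<le> x"
    by (simp add: less_eq_letter_def)
  show "x \<le> y \<Longrightarrow> y \<le> z \<Longrightarrow> x \<le> z"
    by (auto simp: less_eq_letter_def less_letter_def)
  show "x \<le> y \<Longrightarrow> y \<le> x \<Longrightarrow> x = y"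
    by (auto simp: less_eq_letter_def less_letter_def)
  show "x \<le> y \<or> y \<le> x"
    by (cases x; cases y) (auto simp: less_eq_letter_def less_letter_def)
qed

end

definition weakly_increasing :: "nat list \<Rightarrow> (nat \<times> nat \<Rightarrow> 'a::order) \<Rightarrow> bool" where
  "weakly_increasing lam T \<longleftrightarrow>
     (\<forall>i j j'. (i, j) \<in> shifted_diagram lam \<longrightarrow> (i, j') \<in> shifted_diagram lam \<longrightarrow>
        j \<le> j' \<longrightarrow> T (i, j) \<le> T (i, j')) \<and>
     (\<forall>i i' j. (i, j) \<in> shifted_diagram lam \<longrightarrow> (i', j) \<in> shifted_diagram lam \<longrightarrow>
        i \<le> i' \<longrightarrow> T (i, j) \<le> T (i', j))"

text \<open>Extensional functions (\<open>\<rightarrow>\<^sub>E\<close>) are used so that each map on the diagram is represented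
  by exactly one HOL function.\<close>

definition marked_shifted_tableau :: "nat list \<Rightarrow> (nat \<times> nat \<Rightarrow> letter) \<Rightarrow> bool" where
  "marked_shifted_tableau lam T \<longleftrightarrow>
     T \<in> shifted_diagram lam \<rightarrow>\<^sub>E alphabet \<and>
     weakly_increasing lam T \<and>
     (\<forall>i i' j. (i, j) \<in> shifted_diagram lam \<longrightarrow> (i', j) \<in> shifted_diagram lam \<longrightarrow> i < i' \<longrightarrow>
        \<not> is_marked (T (i, j)) \<longrightarrow> \<not> is_marked (T (i', j)) \<longrightarrow> T (i, j) < T (i', j)) \<and>
     (\<forall>i j j'. (i, j) \<in> shifted_diagram lam \<longrightarrow> (i, j') \<in> shifted_diagram lam \<longrightarrow> j < j' \<longrightarrow>
        is_marked (T (i, j)) \<longrightarrow> is_marked (T (i, j')) \<longrightarrow> T (i, j) < T (i, j'))"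

text \<open>Labels are integers, because the map \<open>color_bar C\<close> below can be negative for arbitrary \<open>C\<close>.\<close>

definition shifted_reverse_plane_tableau :: "nat list \<Rightarrow> (nat \<times> nat \<Rightarrow> int) \<Rightarrow> bool" where
  "shifted_reverse_plane_tableau lam R \<longleftrightarrow>
     (\<forall>c \<in> shifted_diagram lam. 0 \<le> R c) \<and> weakly_increasing lam R"

definition color_bar :: "(nat \<times> nat \<Rightarrow> letter) \<Rightarrow> nat \<times> nat \<Rightarrow> int" where
  "color_bar C = (\<lambda>(i, j). if is_marked (C (i, j))
     then int (letter_abs (C (i, j))) - int j
     else int (letter_abs (C (i, j))) - int i)"

definition colored_shifted_tableau :: "nat list \<Rightarrow> (nat \<times> nat \<Rightarrow> letter) \<Rightarrow> bool" where
  "colored_shifted_tableau lam C \<longleftrightarrow>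
     C \<in> shifted_diagram lam \<rightarrow>\<^sub>E alphabet \<and>
     shifted_reverse_plane_tableau lam (color_bar C)"

definition weight :: "nat list \<Rightarrow> (nat \<times> nat \<Rightarrow> letter) \<Rightarrow> nat \<Rightarrow> nat" where
  "weight lam T k = card {c \<in> shifted_diagram lam. letter_abs (T c) = k}"

definition has_weight :: "nat list \<Rightarrow> (nat \<times> nat \<Rightarrow> letter) \<Rightarrow> (nat \<Rightarrow> nat) \<Rightarrow> bool" where
  "has_weight lam T \<alpha> \<longleftrightarrow> (\<forall>k\<ge>1. weight lam T k = \<alpha> k)"

end

theory Submission
  imports Defs "HOL-Library.Poly_Mapping"
begin

text \<open>Both sets of tableaux are finite, so it is enough to see that they have the same number of
elements of each weight. This is an identity of polynomials in variables \<open>x\<^sub>1, \<dots>, x\<^sub>N\<close>, in which a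
tableau contributes the product of \<open>x\<^sub>k\<close> over its letters \<open>k\<close> and \<open>k'\<close>; both sides are the Schur
\<open>Q\<close>-polynomial of \<open>\<lambda>\<close>. No explicit bijection is constructed.

Both generating functions are built one strip at a time. Let \<open>H(w)\<close> and \<open>V(w)\<close> be the operators
that enlarge a shifted shape by a horizontal strip (at most one cell per column) or a vertical
strip (at most one cell per row), where a cell \<open>(i, j)\<close> of content \<open>c = j - i\<close> has the weight \<open>w c\<close>.
In a marked tableau the cells with letter \<open>k'\<close> form a vertical strip and those with letter \<open>k\<close> a
horizontal one, so its generating function is \<open>H(x\<^sub>N) V(x\<^sub>N) \<dots> H(x\<^sub>1) V(x\<^sub>1)\<close> applied to the empty
shape. For a colored tableau \<open>C\<close>, adding the row index to \<open>color_bar C\<close> gives a filling \<open>S\<close> that is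
weakly increasing along rows and strictly increasing down columns, and the letter of a cell is
either \<open>S\<close>, unmarked, or \<open>S + c\<close>, marked. Hence the generating function is that of all such \<open>S\<close>
with weights \<open>x\<^sub>S + x\<^bsub>S+c\<^esub>\<close>: it is \<open>H(w\<^sub>N) \<dots> H(w\<^sub>1)\<close> applied to the empty shape, with
\<open>w\<^sub>t c = x\<^sub>t + x\<^bsub>t+c\<^esub>\<close> and \<open>x\<^sub>k = 0\<close> for \<open>k > N\<close>. This is the shifted counterpart of the formula of
Goulden, Greene and Macdonald for supersymmetric Schur functions.

The two products of operators agree by induction on \<open>N\<close>, using two exchange relations. First
(\<open>strip_exchange_diagonal\<close>), in \<open>H V\<close> only the total weight of a cell on the main diagonal matters,
so in \<open>H(x\<^sub>N) V(x\<^sub>N)\<close> the vertical strip may be confined to contents \<open>c \<ge> 1\<close> if the horizontal one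
gets weight \<open>2 x\<^sub>N\<close> at \<open>c = 0\<close>; then the horizontal factor is \<open>H(w\<^sub>N)\<close>. Second
(\<open>strip_exchange\<close>), a vertical strip of weight \<open>y\<close> confined to contents \<open>c \<ge> k\<close> with \<open>k \<ge> 1\<close> can
be moved past a horizontal strip with weights \<open>x + a\<^sub>c\<close>, where \<open>a\<^sub>c = 0\<close> for \<open>c \<ge> k\<close>; this sets
\<open>a\<^sub>k = y\<close> and confines the vertical strip to \<open>c \<ge> k + 1\<close>. Moving the vertical strip of \<open>y = x\<^sub>N\<close> past
\<open>H(w\<^bsub>N-1\<^esub>), \<dots>, H(w\<^sub>1)\<close> thus inserts precisely the missing occurrences of \<open>x\<^sub>N\<close> (\<open>absorb_variable\<close>), and
what arrives at the empty shape acts trivially, because the first cell of a shape has content 0.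

The exchange relations are local. Given the inner and the outer shape, the sum over the shapes in
between is a product over the diagonals, and the two products are compared by telescoping.\<close>

section \<open>Shifted shapes and their diagonals\<close>

text \<open>A shifted shape is represented by the function that maps \<open>c\<close> to the number of its cells of content
\<open>c\<close>. The inequalities say that the cells form an order ideal: if a cell belongs to the shape, so do
the cell to its left and the cell above it.\<close>

definition profile :: "(nat \<Rightarrow> nat) \<Rightarrow> bool" where
  "profile d \<longleftrightarrow> (\<forall>c. d (Suc c) \<le> d c \<and> d c \<le> Suc (d (Suc c))) \<and> (\<exists>M. \<forall>c\<ge>M. d c = 0)"

lemma profileD:
  assumes "profile d"
  shows "d (Suc c) \<le> d c" "d c \<le> Suc (d (Suc c))"
  using assms by (auto simp: profile_def)

lemma profile_support:
  assumes "profile d"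
  obtains M where "\<forall>c\<ge>M. d c = 0"
  using assms unfolding profile_def by blast

definition cells :: "(nat \<Rightarrow> nat) \<Rightarrow> (nat \<times> nat) set" where
  "cells d = {(i, j). 1 \<le> i \<and> i \<le> j \<and> i \<le> d (j - i)}"

definition diagonal_profile :: "(nat \<times> nat) set \<Rightarrow> nat \<Rightarrow> nat" where
  "diagonal_profile I c = card {i. (i, i + c) \<in> I}"

lemma profile_antimono:
  assumes "profile d" "c \<le> c'" shows "d c' \<le> d c"
  using assms(2)
proof (induction rule: dec_induct)
  case (step n)
  then show ?case using profileD(1)[OF assms(1), of n] by linarith
qed simp

lemma profile_le_add:
  assumes "profile d" shows "d c \<le> d (c + k) + k"
proof (induction k)
  case (Suc k)
  then show ?case using profileD(2)[OF assms, of "c + k"] by simp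
qed simp

lemma cells_left:
  assumes "profile d" "(i, j') \<in> cells d" "i \<le> j" "j \<le> j'"
  shows "(i, j) \<in> cells d"
proof -
  have "d (j' - i) \<le> d (j - i)"
    by (rule profile_antimono[OF assms(1)]) (use assms(4) in simp)
  then show ?thesis using assms by (simp add: cells_def)
qed

lemma cells_above:
  assumes "profile d" "(i', j) \<in> cells d" "1 \<le> i" "i \<le> i'"
  shows "(i, j) \<in> cells d"
proof -
  have "i \<le> i'" "i' \<le> j" "i' \<le> d (j - i')" using assms by (auto simp: cells_def)
  moreover have "d (j - i') \<le> d (j - i' + (i' - i)) + (i' - i)" by (rule profile_le_add[OF assms(1)])
  ultimately have "i' \<le> d (j - i) + (i' - i)" "i \<le> j" by simp_all
  then show ?thesis using assms(3,4) by (simp add: cells_def)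
qed

lemma finite_cells:
  assumes "profile d" shows "finite (cells d)"
proof -
  obtain M where M: "\<forall>c\<ge>M. d c = 0" using assms by (rule profile_support)
  have "i \<le> d 0 \<and> j \<le> d 0 + M" if "(i, j) \<in> cells d" for i j
  proof -
    have ij: "1 \<le> i" "i \<le> j" "i \<le> d (j - i)" using that by (auto simp: cells_def)
    then have "d (j - i) \<noteq> 0" by simp
    then have "j - i < M" using M by (metis leI)
    moreover have "d (j - i) \<le> d 0" by (rule profile_antimono[OF assms]) simp
    ultimately show ?thesis using ij by linarith
  qed
  then have "cells d \<subseteq> {..d 0} \<times> {..d 0 + M}" by auto
  then show ?thesis by (rule finite_subset) simp
qed

lemma cells_empty_iff: "cells d = {} \<longleftrightarrow> (\<forall>c. d c = 0)"
proof
  assume e: "cells d = {}"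
  show "\<forall>c. d c = 0"
  proof
    fix c
    have "(1, 1 + c) \<notin> cells d" using e by simp
    then show "d c = 0" by (simp add: cells_def)
  qed
qed (auto simp: cells_def)

lemma diagonal_profile_cells [simp]: "diagonal_profile (cells d) = d"
proof
  fix c
  have "{i. (i, i + c) \<in> cells d} = {1..d c}" by (auto simp: cells_def)
  then show "diagonal_profile (cells d) c = d c" by (simp add: diagonal_profile_def)
qed

text \<open>An order ideal meets every diagonal in an initial segment, because together with the left and
upper neighbours of a cell it contains the preceding cell on the diagonal.\<close>

lemma order_ideal_profile:
  assumes fin: "finite I"
    and sub: "\<And>i j. (i, j) \<in> I \<Longrightarrow> 1 \<le> i \<and> i \<le> j"
    and left: "\<And>i j. (i, Suc j) \<in> I \<Longrightarrow> i \<le> j \<Longrightarrow> (i, j) \<in> I"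
    and above: "\<And>i j. (Suc i, j) \<in> I \<Longrightarrow> 1 \<le> i \<Longrightarrow> (i, j) \<in> I"
  shows "profile (diagonal_profile I)" "cells (diagonal_profile I) = I"
proof -
  define d where "d = diagonal_profile I"
  have diag: "{i. (i, i + c) \<in> I} = {1..d c}" for c
  proof -
    define D where "D = {i. (i, i + c) \<in> I}"
    have finD: "finite D"
      by (rule finite_subset[of _ "fst ` I"]) (use fin in \<open>force simp: D_def\<close>)+
    have down: "i \<in> D" if "Suc i \<in> D" "1 \<le> i" for i
      using left[of i "i + c"] above[of i "Suc i + c"] that by (simp add: D_def)
    have "\<exists>n. D = {1..n}"
    proof (cases "D = {}")
      case True
      then have "D = {1..0}" by simp
      then show ?thesis by blast
    next
      case False
      have in_D: "k \<in> D" if "1 \<le> k" "k \<le> Max D" for k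
        using that(2,1)
      proof (induction k rule: inc_induct)
        case base
        show ?case using Max_in[OF finD False] .
      next
        case (step k)
        then show ?case using down[of k] by simp
      qed
      have bounds: "1 \<le> k \<and> k \<le> Max D" if "k \<in> D" for k
        using that sub[of k "k + c"] Max_ge[OF finD that] by (simp add: D_def)
      have "k \<in> D \<longleftrightarrow> k \<in> {1..Max D}" for k
        unfolding atLeastAtMost_iff using in_D bounds by blast
      then have "D = {1..Max D}" by (rule set_eqI)
      then show ?thesis by blast
    qed
    then obtain n where n: "D = {1..n}" by blast
    then have "d c = n" unfolding d_def diagonal_profile_def D_def[symmetric] by simp
    then show ?thesis using n by (simp add: D_def)
  qed
  have mem: "(i, j) \<in> I \<longleftrightarrow> 1 \<le> i \<and> i \<le> j \<and> i \<le> d (j - i)" for i j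
  proof (cases "i \<le> j")
    case True
    have "i \<in> {i'. (i', i' + (j - i)) \<in> I} \<longleftrightarrow> i \<in> {1..d (j - i)}" by (simp only: diag)
    then show ?thesis using True by simp
  qed (use sub in blast)
  show "cells (diagonal_profile I) = I"
    using mem by (auto simp: cells_def d_def)
  have "d (Suc c) \<le> d c" for c
  proof (cases "d (Suc c)")
    case (Suc n)
    then have "(d (Suc c), d (Suc c) + Suc c) \<in> I" by (subst mem) simp
    then have "(d (Suc c), d (Suc c) + c) \<in> I" using left by simp
    then show ?thesis by (subst (asm) mem) simp
  qed simp
  moreover have "d c \<le> Suc (d (Suc c))" for c
  proof (cases "d c \<le> 1")
    case False
    then obtain i where i: "d c = Suc i" "1 \<le> i" by (cases "d c") auto
    then have "(Suc i, Suc i + c) \<in> I" by (subst mem) simp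
    then have "(i, Suc i + c) \<in> I" using above i by simp
    then have "i \<le> d (Suc c)" by (subst (asm) mem) (simp add: Suc_diff_le)
    then show ?thesis using i by simp
  qed simp
  moreover have "\<exists>M. \<forall>c\<ge>M. d c = 0"
  proof -
    have "finite (snd ` I)" using fin by simp
    then obtain M where M: "\<forall>j\<in>snd ` I. j \<le> M" using finite_nat_set_iff_bounded_le by blast
    have "d c = 0" if "c \<ge> M" for c
    proof (rule ccontr)
      assume "d c \<noteq> 0"
      then have "(1, 1 + c) \<in> I" by (subst mem) simp
      then have "1 + c \<le> M" using M by force
      then show False using that by simp
    qed
    then show ?thesis by blast
  qed
  ultimately show "profile (diagonal_profile I)" by (simp add: profile_def d_def)
qed

section \<open>Strips and the operators that add them\<close>

text \<open>The bound on \<open>\<nu> c\<close> in the horizontal case says that no two cells of \<open>\<nu>\<close> outside \<open>\<mu>\<close> lie in one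
column: if \<open>(i, j)\<close> and \<open>(i + 1, j)\<close> were two such cells and \<open>c\<close> the content of the lower one, then
\<open>\<mu> (c + 1) < i < \<nu> c\<close>. The vertical case says the same for rows.\<close>

definition strip :: "bool \<Rightarrow> (nat \<Rightarrow> nat) \<Rightarrow> (nat \<Rightarrow> nat) \<Rightarrow> bool" where
  "strip hor \<mu> \<nu> \<longleftrightarrow> profile \<mu> \<and> profile \<nu> \<and>
     (\<forall>c. \<mu> c \<le> \<nu> c \<and> (if hor then \<nu> c \<le> Suc (\<mu> (Suc c)) else \<nu> (Suc c) \<le> \<mu> c))"

text \<open>A strip has at most one cell on each diagonal, so the product runs over its cells.\<close>

definition strip_weight :: "(nat \<Rightarrow> 'a::comm_semiring_1) \<Rightarrow> (nat \<Rightarrow> nat) \<Rightarrow> (nat \<Rightarrow> nat) \<Rightarrow> 'a" where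
  "strip_weight w \<mu> \<nu> = (\<Prod>c | \<mu> c < \<nu> c. w c)"

definition add_strip :: "bool \<Rightarrow> (nat \<Rightarrow> 'a::comm_semiring_1) \<Rightarrow> ((nat \<Rightarrow> nat) \<Rightarrow> 'a) \<Rightarrow> (nat \<Rightarrow> nat) \<Rightarrow> 'a" where
  "add_strip hor w F \<nu> = (\<Sum>\<mu> | strip hor \<mu> \<nu>. strip_weight w \<mu> \<nu> * F \<mu>)"

lemma stripD:
  assumes "strip hor \<mu> \<nu>"
  shows "profile \<mu>" "profile \<nu>" "\<mu> c \<le> \<nu> c" "hor \<Longrightarrow> \<nu> c \<le> Suc (\<mu> (Suc c))" "\<not> hor \<Longrightarrow> \<nu> (Suc c) \<le> \<mu> c"
  using assms by (auto simp: strip_def split: if_splits)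

lemma strip_le_Suc:
  assumes "strip hor \<mu> \<nu>"
  shows "\<nu> c \<le> Suc (\<mu> c)"
  using stripD(1,2)[OF assms] stripD(3-)[OF assms, of c] profileD[of \<mu> c] profileD[of \<nu> c] by (cases hor) auto

lemma finite_below_profile:
  assumes "profile \<nu>" shows "finite {\<mu>. \<forall>c. \<mu> c \<le> \<nu> c}"
proof -
  obtain M where M: "\<forall>c\<ge>M. \<nu> c = 0" using assms by (rule profile_support)
  have "{\<mu>. \<forall>c. \<mu> c \<le> \<nu> c} \<subseteq> (\<lambda>f c. if c < M then f c else 0) ` (PiE {..<M} (\<lambda>c. {..\<nu> c}))"
  proof
    fix \<mu> assume \<mu>: "\<mu> \<in> {\<mu>. \<forall>c. \<mu> c \<le> \<nu> c}"
    have "\<mu> = (\<lambda>c. if c < M then restrict \<mu> {..<M} c else 0)"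
    proof
      fix c show "\<mu> c = (if c < M then restrict \<mu> {..<M} c else 0)"
        using \<mu> M by (cases "c < M") (auto dest: spec[of _ c])
    qed
    moreover have "restrict \<mu> {..<M} \<in> PiE {..<M} (\<lambda>c. {..\<nu> c})" using \<mu> by auto
    ultimately show "\<mu> \<in> (\<lambda>f c. if c < M then f c else 0) ` (PiE {..<M} (\<lambda>c. {..\<nu> c}))" by blast
  qed
  then show ?thesis by (rule finite_subset) (intro finite_imageI finite_PiE, auto)
qed

lemma finite_strips: "finite {\<mu>. strip hor \<mu> \<nu>}"
proof (cases "profile \<nu>")
  case True
  show ?thesis by (rule finite_subset[OF _ finite_below_profile[OF True]]) (auto dest: stripD)
next
  case False
  then show ?thesis by (simp add: strip_def)
qed

lemma strip_cells_subset:
  assumes "strip h \<mu> \<kappa>" shows "cells \<mu> \<subseteq> cells \<kappa>"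
  by (auto simp: cells_def intro: le_trans[OF _ stripD(3)[OF assms]])

lemma prod_cells_strip:
  assumes s: "strip h \<mu> \<kappa>"
  shows "(\<Prod>(i, j)\<in>cells \<kappa> - cells \<mu>. w (j - i)) = strip_weight w \<mu> \<kappa>"
  unfolding strip_weight_def
proof (rule prod.reindex_bij_witness[where i = "\<lambda>c. (\<kappa> c, \<kappa> c + c)" and j = "\<lambda>(i, j). j - i"])
  fix a assume a: "a \<in> cells \<kappa> - cells \<mu>"
  obtain i j where ij: "a = (i, j)" by (cases a)
  have *: "i \<le> j" "\<mu> (j - i) < i" "i \<le> \<kappa> (j - i)" using a ij by (auto simp: cells_def)
  then show "(\<lambda>c. (\<kappa> c, \<kappa> c + c)) (case a of (i, j) \<Rightarrow> j - i) = a"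
    using strip_le_Suc[OF s, of "j - i"] ij by simp
  show "(case a of (i, j) \<Rightarrow> j - i) \<in> {c. \<mu> c < \<kappa> c}" using * ij by simp
qed (auto simp: cells_def)

lemma add_strip_cong:
  assumes "\<And>\<mu>. profile \<mu> \<Longrightarrow> F \<mu> = G \<mu>"
  shows "add_strip h w F = add_strip h w G"
  unfolding add_strip_def using assms by (intro ext sum.cong refl) (auto dest: stripD(1))

section \<open>Two successive strips\<close>

text \<open>The entry at \<open>(\<mu>, \<kappa>)\<close> of the product of two strip operators, the first of which acts with weight
\<open>h\<close> and the second with weight \<open>v\<close>.\<close>

definition two_strips where
  "two_strips hor h hor' v \<mu> \<kappa> =
    (\<Sum>\<nu> | strip hor \<mu> \<nu> \<and> strip hor' \<nu> \<kappa>. strip_weight h \<mu> \<nu> * strip_weight v \<nu> \<kappa>)"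

lemma add_two_strips:
  "add_strip hor' v (add_strip hor h F) \<kappa> =
    (\<Sum>\<mu> | profile \<kappa> \<and> (\<forall>c. \<mu> c \<le> \<kappa> c). two_strips hor h hor' v \<mu> \<kappa> * F \<mu>)"
proof (cases "profile \<kappa>")
  case True
  let ?B = "{\<mu>. \<forall>c. \<mu> c \<le> \<kappa> c}"
  have "add_strip hor' v (add_strip hor h F) \<kappa> =
      (\<Sum>\<nu> | strip hor' \<nu> \<kappa>. \<Sum>\<mu> | strip hor \<mu> \<nu>. strip_weight v \<nu> \<kappa> * (strip_weight h \<mu> \<nu> * F \<mu>))"
    by (simp add: add_strip_def sum_distrib_left)
  also have "\<dots> = (\<Sum>\<nu> | strip hor' \<nu> \<kappa>. \<Sum>\<mu> | \<mu> \<in> ?B \<and> strip hor \<mu> \<nu>. strip_weight v \<nu> \<kappa> * (strip_weight h \<mu> \<nu> * F \<mu>))"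
    by (intro sum.cong refl Collect_cong) (auto dest: stripD(3) intro: order_trans)
  also have "\<dots> = (\<Sum>\<mu>\<in>?B. \<Sum>\<nu> | \<nu> \<in> {\<nu>. strip hor' \<nu> \<kappa>} \<and> strip hor \<mu> \<nu>. strip_weight v \<nu> \<kappa> * (strip_weight h \<mu> \<nu> * F \<mu>))"
    by (rule sum.swap_restrict) (auto intro: finite_strips finite_below_profile True)
  also have "\<dots> = (\<Sum>\<mu>\<in>?B. two_strips hor h hor' v \<mu> \<kappa> * F \<mu>)"
    unfolding two_strips_def sum_distrib_right
    by (intro sum.cong refl) (auto simp: mult_ac)
  finally show ?thesis using True by simp
qed (simp add: add_strip_def strip_def)

text \<open>The variant of \<open>prod_sum_PiE\<close> for functions that vanish, instead of being undefined, outside their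
domain; profiles are of this kind.\<close>

lemma sum_prod_choices:
  fixes f :: "nat \<Rightarrow> nat \<Rightarrow> 'a::comm_semiring_1"
  assumes "\<And>c. finite (A c)"
  shows "(\<Sum>\<nu> | (\<forall>c<M. \<nu> c \<in> A c) \<and> (\<forall>c\<ge>M. \<nu> c = 0). \<Prod>c<M. f c (\<nu> c)) = (\<Prod>c<M. \<Sum>a\<in>A c. f c a)"
proof (induction M)
  case 0
  have "{\<nu>::nat\<Rightarrow>nat. \<forall>c. \<nu> c = 0} = {\<lambda>_. 0}" by auto
  then show ?case by simp
next
  case (Suc M)
  let ?S = "\<lambda>M. {\<nu>. (\<forall>c<M. \<nu> c \<in> A c) \<and> (\<forall>c\<ge>M. \<nu> c = 0)}"
  have "(\<Prod>c<Suc M. \<Sum>a\<in>A c. f c a) = (\<Sum>\<nu>\<in>?S M. \<Sum>a\<in>A M. (\<Prod>c<M. f c (\<nu> c)) * f M a)"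
    by (simp add: Suc.IH[symmetric] sum_product)
  also have "\<dots> = (\<Sum>(\<nu>, a)\<in>?S M \<times> A M. (\<Prod>c<M. f c (\<nu> c)) * f M a)"
    by (simp add: sum.cartesian_product)
  also have "\<dots> = (\<Sum>\<nu>\<in>?S (Suc M). \<Prod>c<Suc M. f c (\<nu> c))"
    by (rule sum.reindex_bij_witness[where i = "\<lambda>\<nu>. (\<nu>(M := 0), \<nu> M)" and j = "\<lambda>(\<nu>, a). \<nu>(M := a)"])
       (auto intro!: arg_cong2[where f = times] prod.cong simp: less_Suc_eq fun_eq_iff)
  finally show ?case by simp
qed

lemma strip_weight_lessThan:
  assumes "\<And>c. c \<ge> M \<Longrightarrow> \<nu> c = 0"
  shows "strip_weight w \<mu> \<nu> = (\<Prod>c<M. if \<mu> c < \<nu> c then w c else 1)"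
proof -
  have "{c. \<mu> c < \<nu> c} = {c\<in>{..<M}. \<mu> c < \<nu> c}" using assms by (auto simp: not_le[symmetric])
  then show ?thesis unfolding strip_weight_def by (simp add: prod.inter_filter[symmetric])
qed

text \<open>The weight of a pair of strips is a product over the diagonals. If the conditions on the
intermediate shape \<open>\<nu>\<close> also decouple into one condition on each \<open>\<nu> c\<close>, so does the sum.\<close>

lemma two_strips_factor:
  fixes h v :: "nat \<Rightarrow> 'a::comm_semiring_1"
  assumes choices: "\<And>\<nu>. strip hor \<mu> \<nu> \<and> strip hor' \<nu> \<kappa> \<longleftrightarrow> (\<forall>c. \<nu> c \<in> A c)"
    and A: "\<And>c. finite (A c)" "\<And>c. c \<ge> M \<Longrightarrow> A c = {0}"
    and M: "\<And>c. c \<ge> M \<Longrightarrow> \<kappa> c = 0"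
  shows "two_strips hor h hor' v \<mu> \<kappa> =
    (\<Prod>c<M. \<Sum>a\<in>A c. (if \<mu> c < a then h c else 1) * (if a < \<kappa> c then v c else 1))"
proof -
  have "two_strips hor h hor' v \<mu> \<kappa> =
      (\<Sum>\<nu> | \<forall>c. \<nu> c \<in> A c. \<Prod>c<M. (if \<mu> c < \<nu> c then h c else 1) * (if \<nu> c < \<kappa> c then v c else 1))"
    unfolding two_strips_def choices
  proof (intro sum.cong refl)
    fix \<nu> assume "\<nu> \<in> {\<nu>. \<forall>c. \<nu> c \<in> A c}"
    then have "\<nu> c = 0" if "c \<ge> M" for c using A(2)[OF that] by (metis mem_Collect_eq singletonD)
    then show "strip_weight h \<mu> \<nu> * strip_weight v \<nu> \<kappa> =
      (\<Prod>c<M. (if \<mu> c < \<nu> c then h c else 1) * (if \<nu> c < \<kappa> c then v c else 1))"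
      using M by (simp add: strip_weight_lessThan[of M] prod.distrib)
  qed
  also have "{\<nu>. \<forall>c. \<nu> c \<in> A c} = {\<nu>. (\<forall>c<M. \<nu> c \<in> A c) \<and> (\<forall>c\<ge>M. \<nu> c = 0)}"
    using A(2) by (metis (no_types, opaque_lifting) linorder_not_le singleton_iff)
  also have "(\<Sum>\<nu>\<in>\<dots>. \<Prod>c<M. (if \<mu> c < \<nu> c then h c else 1) * (if \<nu> c < \<kappa> c then v c else 1)) = 
    (\<Prod>c<M. \<Sum>a\<in>A c. (if \<mu> c < a then h c else 1) * (if a < \<kappa> c then v c else 1))"
    by (rule sum_prod_choices) (rule A)
  finally show ?thesis .
qed

text \<open>At most one new cell per diagonal: the only pairs of shapes for which the exchange relations have
nonzero terms.\<close>

definition thin :: "(nat \<Rightarrow> nat) \<Rightarrow> (nat \<Rightarrow> nat) \<Rightarrow> bool" where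
  "thin \<mu> \<kappa> \<longleftrightarrow> profile \<mu> \<and> profile \<kappa> \<and> (\<forall>c. \<mu> c \<le> \<kappa> c \<and> \<kappa> c \<le> Suc (\<mu> c))"

lemma thin_support:
  assumes "thin \<mu> \<kappa>" shows "\<exists>M. \<forall>c\<ge>M. \<kappa> c = 0"
  using assms unfolding thin_def profile_def by blast

text \<open>The values that \<open>\<nu> c\<close> may take if a horizontal strip leads from \<open>\<mu>\<close> to \<open>\<nu>\<close> and a vertical strip from
\<open>\<nu>\<close> to \<open>\<kappa>\<close>. New cells on the diagonals \<open>c\<close> and \<open>c + 1\<close> are neighbours, in the same row if
\<open>\<mu> c = \<mu> (c + 1)\<close> and in the same column otherwise. In a row the left cell, of content \<open>c\<close>, cannot
belong to the outer vertical strip, since then both would; in a column the lower cell, again of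
content \<open>c\<close>, cannot belong to the inner horizontal strip. A new cell without new neighbour on the
diagonal \<open>c + 1\<close> may belong to either strip.\<close>

definition hv_choices where
  "hv_choices \<mu> \<nu> c = (if \<mu> c < \<nu> c then if \<mu> (Suc c) < \<nu> (Suc c)
      then if \<mu> c = \<mu> (Suc c) then {\<nu> c} else {\<mu> c} else {\<mu> c, \<nu> c} else {\<mu> c :: nat})"

text \<open>The same for a vertical strip followed by a horizontal one. Now the right cell of a horizontal pair
and the upper cell of a vertical pair are forced, so that the choice on a diagonal depends on the
preceding diagonal instead of the following one.\<close>

definition vh_choices where
  "vh_choices \<mu> \<nu> c = (if \<mu> c < \<nu> c then if c > 0 \<and> \<mu> (c - 1) < \<nu> (c - 1)
      then if \<mu> (c - 1) = \<mu> c then {\<mu> c} else {\<nu> c} else {\<mu> c, \<nu> c} else {\<mu> c :: nat})"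

lemma hv_interval:
  assumes "profile \<mu>" "profile \<kappa>" "\<And>c. \<mu> c \<le> \<kappa> c \<and> \<kappa> c \<le> Suc (\<mu> c)"
  shows "strip True \<mu> \<nu> \<and> strip False \<nu> \<kappa> \<longleftrightarrow> (\<forall>c. \<nu> c \<in> hv_choices \<mu> \<kappa> c)"
proof (intro iffI allI)
  fix c
  assume "strip True \<mu> \<nu> \<and> strip False \<nu> \<kappa>"
  then have s: "strip True \<mu> \<nu>" "strip False \<nu> \<kappa>" by auto
  show "\<nu> c \<in> hv_choices \<mu> \<kappa> c"
    using stripD(3-)[OF s(1), of c] stripD(3-)[OF s(2), of c] stripD(3-)[OF s(1), of "Suc c"] stripD(3-)[OF s(2), of "Suc c"]
      profileD[OF assms(1), of c] profileD[OF assms(2), of c] assms(3)[of c] assms(3)[of "Suc c"]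
      profileD[OF stripD(2)[OF s(1)], of c]
    unfolding hv_choices_def by auto
next
  assume *: "\<forall>c. \<nu> c \<in> hv_choices \<mu> \<kappa> c"
  have b: "\<mu> c \<le> \<nu> c \<and> \<nu> c \<le> \<kappa> c" for c
    using *[rule_format, of c] assms(3)[of c] by (auto simp: hv_choices_def split: if_splits)
  have c: "\<nu> (Suc c) \<le> \<nu> c \<and> \<nu> c \<le> Suc (\<nu> (Suc c)) \<and> \<nu> c \<le> Suc (\<mu> (Suc c)) \<and> \<kappa> (Suc c) \<le> \<nu> c" for c
    using *[rule_format, of c] *[rule_format, of "Suc c"] assms(3)[of c] assms(3)[of "Suc c"] 
     b[of c] b[of "Suc c"]
      profileD[OF assms(1), of c] profileD[OF assms(2), of c]
    by (simp add: hv_choices_def split: if_splits; linarith)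
  obtain M where "\<forall>c\<ge>M. \<kappa> c = 0" using assms(2) by (rule profile_support)
  then have "profile \<nu>" unfolding profile_def using b c by (metis le_zero_eq)
  then show "strip True \<mu> \<nu> \<and> strip False \<nu> \<kappa>"
    using assms b c by (auto simp: strip_def)
qed

lemma vh_interval:
  assumes "profile \<mu>" "profile \<kappa>" "\<And>c. \<mu> c \<le> \<kappa> c \<and> \<kappa> c \<le> Suc (\<mu> c)"
  shows "strip False \<mu> \<nu> \<and> strip True \<nu> \<kappa> \<longleftrightarrow> (\<forall>c. \<nu> c \<in> vh_choices \<mu> \<kappa> c)"
proof (intro iffI allI)
  fix c
  assume "strip False \<mu> \<nu> \<and> strip True \<nu> \<kappa>"
  then have s: "strip False \<mu> \<nu>" "strip True \<nu> \<kappa>" by auto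
  show "\<nu> c \<in> vh_choices \<mu> \<kappa> c"
  proof (cases c)
    case 0
    then show ?thesis using stripD(3)[OF s(1), of c] stripD(3)[OF s(2), of c] assms(3)[of c]
      unfolding vh_choices_def by auto
  next
    case (Suc b)
    then show ?thesis using stripD(3-)[OF s(1), of b] stripD(3-)[OF s(2), of b] stripD(3-)[OF s(1), of "Suc b"] stripD(3-)[OF s(2), of "Suc b"]
      profileD[OF assms(1), of b] profileD[OF assms(2), of b] assms(3)[of b] assms(3)[of "Suc b"]
      profileD[OF stripD(2)[OF s(1)], of b]
    unfolding vh_choices_def by auto
  qed
next
  assume *: "\<forall>c. \<nu> c \<in> vh_choices \<mu> \<kappa> c"
  have b: "\<mu> c \<le> \<nu> c \<and> \<nu> c \<le> \<kappa> c" for c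
    using *[rule_format, of c] assms(3)[of c] by (auto simp: vh_choices_def split: if_splits)
  have c: "\<nu> (Suc c) \<le> \<nu> c \<and> \<nu> c \<le> Suc (\<nu> (Suc c)) \<and> \<kappa> c \<le> Suc (\<nu> (Suc c)) \<and> \<nu> (Suc c) \<le> \<mu> c" for c
    using *[rule_format, of c] *[rule_format, of "Suc c"] assms(3)[of c] assms(3)[of "Suc c"] 
     b[of c] b[of "Suc c"]
      profileD[OF assms(1), of c] profileD[OF assms(2), of c]
    by (simp add: vh_choices_def split: if_splits; linarith)
  obtain M where "\<forall>c\<ge>M. \<kappa> c = 0" using assms(2) by (rule profile_support)
  then have "profile \<nu>" unfolding profile_def using b c by (metis le_zero_eq)
  then show "strip False \<mu> \<nu> \<and> strip True \<nu> \<kappa>"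
    using assms b c by (auto simp: strip_def)
qed

lemma hv_factor:
  assumes "thin \<mu> \<kappa>" "\<forall>c\<ge>M. \<kappa> c = 0"
  shows "two_strips True h False v \<mu> \<kappa> = (\<Prod>c<M. if \<mu> c < \<kappa> c then
       if \<mu> (Suc c) < \<kappa> (Suc c) then if \<mu> c = \<mu> (Suc c) then h c else v c else h c + v c else 1)"
proof -
  note thin = assms(1)[unfolded thin_def]
  have le: "\<mu> c \<le> \<kappa> c" "\<kappa> c \<le> Suc (\<mu> c)" for c using thin by auto
  have "two_strips True h False v \<mu> \<kappa> = (\<Prod>c<M. \<Sum>a\<in>hv_choices \<mu> \<kappa> c. (if \<mu> c < a then h c else 1) * (if a < \<kappa> c then v c else 1))"
  proof (rule two_strips_factor)
    show "strip True \<mu> \<nu> \<and> strip False \<nu> \<kappa> \<longleftrightarrow> (\<forall>c. \<nu> c \<in> hv_choices \<mu> \<kappa> c)" for \<nu>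
      by (rule hv_interval) (use thin in auto)
    show "hv_choices \<mu> \<kappa> c = {0}" if "c \<ge> M" for c
      using assms(2) that le[of c] by (auto simp: hv_choices_def)
  qed (use assms in \<open>auto simp: hv_choices_def\<close>)
  also have "\<dots> = (\<Prod>c<M. if \<mu> c < \<kappa> c then
       if \<mu> (Suc c) < \<kappa> (Suc c) then if \<mu> c = \<mu> (Suc c) then h c else v c else h c + v c else 1)"
    using le by (intro prod.cong refl) (auto simp: hv_choices_def add.commute)
  finally show ?thesis .
qed

lemma vh_factor:
  assumes "thin \<mu> \<kappa>" "\<forall>c\<ge>M. \<kappa> c = 0"
  shows "two_strips False v True h \<mu> \<kappa> = (\<Prod>c<M. if \<mu> c < \<kappa> c then
       if c > 0 \<and> \<mu> (c - 1) < \<kappa> (c - 1) then if \<mu> (c - 1) = \<mu> c then h c else v c else h c + v c else 1)"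
proof -
  note thin = assms(1)[unfolded thin_def]
  have le: "\<mu> c \<le> \<kappa> c" "\<kappa> c \<le> Suc (\<mu> c)" for c using thin by auto
  have "two_strips False v True h \<mu> \<kappa> = (\<Prod>c<M. \<Sum>a\<in>vh_choices \<mu> \<kappa> c. (if \<mu> c < a then v c else 1) * (if a < \<kappa> c then h c else 1))"
  proof (rule two_strips_factor)
    show "strip False \<mu> \<nu> \<and> strip True \<nu> \<kappa> \<longleftrightarrow> (\<forall>c. \<nu> c \<in> vh_choices \<mu> \<kappa> c)" for \<nu>
      by (rule vh_interval) (use thin in auto)
    show "vh_choices \<mu> \<kappa> c = {0}" if "c \<ge> M" for c
      using assms(2) that le[of c] by (auto simp: vh_choices_def)
  qed (use assms in \<open>auto simp: vh_choices_def\<close>)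
  also have "\<dots> = (\<Prod>c<M. if \<mu> c < \<kappa> c then
       if c > 0 \<and> \<mu> (c - 1) < \<kappa> (c - 1) then if \<mu> (c - 1) = \<mu> c then h c else v c else h c + v c else 1)"
    using le by (intro prod.cong refl) (auto simp: vh_choices_def add.commute)
  finally show ?thesis .
qed

lemma vh_not_thin:
  assumes "\<not> thin \<mu> \<kappa>"
  shows "two_strips False v True h \<mu> \<kappa> = 0"
proof -
  have "thin \<mu> \<kappa>" if s: "strip False \<mu> \<nu>" "strip True \<nu> \<kappa>" for \<nu>
  proof -
    have "\<mu> c \<le> \<kappa> c \<and> \<kappa> c \<le> Suc (\<mu> c)" for c
      using stripD(3-)[OF s(1), of c] stripD(3-)[OF s(2), of c] by auto
    then show ?thesis using s by (auto simp: thin_def dest: stripD(1,2))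
  qed
  then show ?thesis using assms unfolding two_strips_def by (intro sum.neutral) auto
qed

text \<open>Two new cells on one diagonal would need a third one next to them that fits into neither strip; on
the main diagonal this argument breaks down, since the lower cell there has no left neighbour, but
then one of the two cells lies in the vertical strip and contributes the factor \<open>v 0\<close>.\<close>

lemma hv_not_thin:
  assumes "\<not> thin \<mu> \<kappa>" "v 0 = 0"
  shows "two_strips True h False v \<mu> \<kappa> = 0"
proof -
  have "strip_weight v \<nu> \<kappa> = 0" if s: "strip True \<mu> \<nu>" "strip False \<nu> \<kappa>" for \<nu>
  proof -
    have 1: "\<mu> c \<le> \<kappa> c" for c
      using stripD(3)[OF s(1), of c] stripD(3)[OF s(2), of c] by auto
    have 2: "\<kappa> (Suc b) \<le> Suc (\<mu> (Suc b))" for b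
      using stripD(3-)[OF s(1), of b] stripD(3-)[OF s(2), of b] by auto
    have "\<not> \<kappa> 0 \<le> Suc (\<mu> 0)"
    proof
      assume "\<kappa> 0 \<le> Suc (\<mu> 0)"
      then have "\<kappa> c \<le> Suc (\<mu> c)" for c using 2 by (cases c) auto
      with 1 s assms(1) show False by (auto simp: thin_def dest: stripD(1,2))
    qed
    then have *: "\<nu> 0 < \<kappa> 0" using strip_le_Suc[OF s(1), of 0] by auto
    obtain M where M: "\<forall>c\<ge>M. \<kappa> c = 0" using stripD(2)[OF s(2)] by (rule profile_support)
    have "c < M" if "\<nu> c < \<kappa> c" for c
      using that M by (metis leI not_less_zero)
    then have "{c. \<nu> c < \<kappa> c} \<subseteq> {..<M}" by blast
    then have "finite {c. \<nu> c < \<kappa> c}" by (rule finite_subset) simp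
    with * assms(2) show ?thesis unfolding strip_weight_def by (intro prod_zero) auto
  qed
  then show ?thesis unfolding two_strips_def by (intro sum.neutral) auto
qed

section \<open>Exchange relations\<close>

text \<open>By \<open>hv_factor\<close> and \<open>vh_factor\<close>, each side is a product over the diagonals in which a pair of
consecutive new cells contributes a factor at its lower content on the left, and at its higher
content on the right; the cell at the opposite end of a run of new cells is free and contributes the
total weight \<open>t\<close>. The hypotheses on \<open>h\<close> and \<open>v\<close> allow the free end to be carried across one pair.\<close>

theorem strip_exchange:
  fixes h v h' v' t :: "nat \<Rightarrow> 'a::comm_semiring_1"
  assumes t: "\<And>c. h c + v c = t c" "\<And>c. h' c + v' c = t c"
    and h: "\<And>c. h c * t (Suc c) = t c * h' (Suc c)"
    and v: "\<And>c. v c * t (Suc c) = t c * v' (Suc c)"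
    and v0: "v 0 = 0"
  shows "add_strip False v (add_strip True h F) = add_strip True h' (add_strip False v' F)"
proof -
  have "two_strips True h False v \<mu> \<kappa> = two_strips False v' True h' \<mu> \<kappa>" for \<mu> \<kappa>
  proof (cases "thin \<mu> \<kappa>")
    case True
    define L where "L c = (if \<mu> c < \<kappa> c then
       if \<mu> (Suc c) < \<kappa> (Suc c) then if \<mu> c = \<mu> (Suc c) then h c else v c else h c + v c else 1)" for c
    define R where "R c = (if \<mu> c < \<kappa> c then
       if c > 0 \<and> \<mu> (c - 1) < \<kappa> (c - 1) then if \<mu> (c - 1) = \<mu> c then h' c else v' c else h' c + v' c else 1)" for c
    define V where "V c = (if \<mu> c < \<kappa> c then t c else 1)" for c
    \<comment> \<open>\<open>V c\<close> is the weight of the free cell, if there is one, when it has been carried to the diagonal \<open>c\<close>.\<close>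
    have step: "L c * V (Suc c) = V c * R (Suc c)" for c
      using h[of c] v[of c] t by (auto simp: L_def R_def V_def)
    have tele: "(\<Prod>c<m. L c) * V m = (\<Prod>c<Suc m. R c)" for m
    proof (induction m)
      case 0
      show ?case using t by (simp add: V_def R_def)
    next
      case (Suc m)
      have "(\<Prod>c<Suc m. L c) * V (Suc m) = (\<Prod>c<m. L c) * V m * R (Suc m)"
        using step[of m] by (simp add: mult.assoc)
      then show ?case using Suc.IH by simp
    qed
    obtain M where M: "\<forall>c\<ge>M. \<kappa> c = 0"
      using thin_support[OF True] by blast
    then have "V M = 1" "R M = 1" by (auto simp: V_def R_def)
    with tele[of M] have "(\<Prod>c<M. L c) = (\<Prod>c<M. R c)" by simp
    then show ?thesis unfolding hv_factor[OF True M] vh_factor[OF True M] L_def R_def .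
  qed (simp add: vh_not_thin hv_not_thin v0)
  then show ?thesis by (simp add: fun_eq_iff add_two_strips)
qed

text \<open>A new cell on the main diagonal has no predecessor, so by \<open>vh_factor\<close> it is always free to belong to
either strip.\<close>

lemma strip_exchange_diagonal:
  fixes h v h' v' :: "nat \<Rightarrow> 'a::comm_semiring_1"
  assumes "h 0 + v 0 = h' 0 + v' 0" "\<And>c. c > 0 \<Longrightarrow> h c = h' c" "\<And>c. c > 0 \<Longrightarrow> v c = v' c"
  shows "add_strip True h (add_strip False v F) = add_strip True h' (add_strip False v' F)"
proof -
  have "two_strips False v True h \<mu> \<kappa> = two_strips False v' True h' \<mu> \<kappa>" for \<mu> \<kappa>
  proof (cases "thin \<mu> \<kappa>")
    case True
    obtain M where M: "\<forall>c\<ge>M. \<kappa> c = 0"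
      using thin_support[OF True] by blast
    have "h c + v c = h' c + v' c" for c using assms by (cases "c = 0") auto
    then show ?thesis unfolding vh_factor[OF True M] using assms(2,3) by (intro prod.cong refl) auto
  qed (simp add: vh_not_thin)
  then show ?thesis by (simp add: fun_eq_iff add_two_strips)
qed

section \<open>Equality of the two generating functions\<close>

definition empty_shape :: "(nat \<Rightarrow> nat) \<Rightarrow> 'a::comm_semiring_1" where
  "empty_shape d = (if \<forall>c. d c = 0 then 1 else 0)"

primrec marked_gf :: "(nat \<Rightarrow> 'a::comm_semiring_1) \<Rightarrow> nat \<Rightarrow> (nat \<Rightarrow> nat) \<Rightarrow> 'a" where
  "marked_gf x 0 = empty_shape"
| "marked_gf x (Suc t) = add_strip True (\<lambda>_. x (Suc t)) (add_strip False (\<lambda>_. x (Suc t)) (marked_gf x t))"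

text \<open>The \<open>t\<close>-th strip also involves the later variables \<open>x (t + c)\<close>, so that the first \<open>N\<close> strips describe
the tableaux with letters up to \<open>N\<close> only if \<open>x\<close> vanishes beyond \<open>N\<close>.\<close>

primrec colored_gf :: "(nat \<Rightarrow> 'a::comm_semiring_1) \<Rightarrow> nat \<Rightarrow> (nat \<Rightarrow> nat) \<Rightarrow> 'a" where
  "colored_gf x 0 = empty_shape"
| "colored_gf x (Suc t) = add_strip True (\<lambda>c. x (Suc t) + x (Suc t + c)) (colored_gf x t)"

text \<open>A nonempty vertical strip added to the empty shape is the single cell of content 0.\<close>

lemma vertical_strip_empty_shape:
  fixes v :: "nat \<Rightarrow> 'a::comm_semiring_1"
  assumes "v 0 = 0" shows "add_strip False v empty_shape = empty_shape"
proof
  fix \<kappa> :: "nat \<Rightarrow> nat"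
  have "add_strip False v empty_shape \<kappa> = (\<Sum>\<mu> | strip False \<mu> \<kappa>. if \<mu> = (\<lambda>_. 0) then strip_weight v (\<lambda>_. 0) \<kappa> else 0)"
    unfolding add_strip_def
  proof (intro sum.cong refl)
    fix \<mu> :: "nat \<Rightarrow> nat"
    have "(\<forall>c. \<mu> c = 0) \<longleftrightarrow> \<mu> = (\<lambda>_. 0)" by (simp add: fun_eq_iff)
    then show "strip_weight v \<mu> \<kappa> * empty_shape \<mu> = (if \<mu> = (\<lambda>_. 0) then strip_weight v (\<lambda>_. 0) \<kappa> else 0)"
      by (simp add: empty_shape_def)
  qed
  also have "\<dots> = (if strip False (\<lambda>_. 0) \<kappa> then strip_weight v (\<lambda>_. 0) \<kappa> else 0)"
    using finite_strips[of False \<kappa>] by (simp add: sum.delta)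
  also have "\<dots> = empty_shape \<kappa>"
  proof (cases "\<forall>c. \<kappa> c = 0")
    case True
    then show ?thesis by (auto simp: strip_def strip_weight_def profile_def empty_shape_def)
  next
    case False
    have "strip_weight v (\<lambda>_. 0) \<kappa> = 0" if s: "strip False (\<lambda>_. 0) \<kappa>"
    proof -
      have "\<kappa> (Suc c) = 0" for c using stripD(5)[OF s, of c] by simp
      then have 1: "\<kappa> c = 0" if "c \<noteq> 0" for c using that by (cases c) auto
      then have "\<kappa> 0 \<noteq> 0" using False by metis
      with 1 have "{c. 0 < \<kappa> c} = {0}" by force
      then show ?thesis by (simp add: strip_weight_def assms)
    qed
    then show ?thesis using False by (auto simp: empty_shape_def)
  qed
  finally show "add_strip False v empty_shape \<kappa> = empty_shape \<kappa>" .
qed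

text \<open>The vertical strip of the variable \<open>x\<^bsub>N+1\<^esub>\<close> passes the factors with weights \<open>x\<^sub>t + x\<^bsub>t+c\<^esub>\<close> in the order of
decreasing \<open>t\<close>. In front of the factor for \<open>t\<close> it is confined to the contents \<open>c\<close> with
\<open>t + c > N\<close>, and the exchange adds to this factor the one occurrence of \<open>x\<^bsub>N+1\<^esub>\<close> it lacked, at
\<open>c = N + 1 - t\<close>.\<close>

lemma absorb_variable:
  fixes x :: "nat \<Rightarrow> 'a::comm_semiring_1"
  assumes "t \<le> N"
  shows "add_strip False (\<lambda>c. if N < t + c then x (Suc N) else 0)
      (colored_gf (\<lambda>k. if k \<le> N then x k else 0) t)
    = colored_gf (\<lambda>k. if k \<le> Suc N then x k else 0) t"
  using assms
proof (induction t)
  case 0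
  show ?case by (simp add: vertical_strip_empty_shape)
next
  case (Suc t)
  let ?x = "\<lambda>k. if k \<le> N then x k else 0" and ?x' = "\<lambda>k. if k \<le> Suc N then x k else 0"
  let ?h = "\<lambda>c. ?x (Suc t) + ?x (Suc t + c)" and ?v = "\<lambda>c. if N < Suc t + c then x (Suc N) else 0"
  let ?h' = "\<lambda>c. ?x' (Suc t) + ?x' (Suc t + c)" and ?v' = "\<lambda>c. if N < t + c then x (Suc N) else 0"
  have "add_strip False ?v (add_strip True ?h (colored_gf ?x t)) =
      add_strip True ?h' (add_strip False ?v' (colored_gf ?x t))"
  proof (rule strip_exchange[where t = "\<lambda>c. ?h c + ?v c"])
    fix c
    \<comment> \<open>The threshold of the vertical strip is \<open>k = N - t\<close>; the cases are \<open>c < k - 1\<close>, \<open>c = k - 1\<close>, \<open>c = k\<close> and \<open>c > k\<close>.\<close>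
    consider "Suc t + c < N" | "Suc t + c = N" | "t + c = N" | "t + c > N" by linarith
    note cs = this
    show "?h' c + ?v' c = ?h c + ?v c"
      using cs Suc.prems by cases auto
    show "?h c * (?h (Suc c) + ?v (Suc c)) = (?h c + ?v c) * ?h' (Suc c)"
      using cs Suc.prems by cases (auto simp: algebra_simps)
    show "?v c * (?h (Suc c) + ?v (Suc c)) = (?h c + ?v c) * ?v' (Suc c)"
      using cs Suc.prems by cases (auto simp: algebra_simps)
  qed (use Suc.prems in auto)
  then show ?case using Suc by simp
qed

theorem marked_gf_eq_colored_gf:
  "marked_gf x N = colored_gf (\<lambda>k. if k \<le> N then x k else 0) N"
proof (induction N)
  case 0
  show ?case by simp
next
  case (Suc N)
  let ?y = "x (Suc N)"
  have "marked_gf x (Suc N) = add_strip True (\<lambda>_. ?y) (add_strip False (\<lambda>_. ?y) (colored_gf (\<lambda>k. if k \<le> N then x k else 0) N))"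
    by (simp add: Suc.IH)
  \<comment> \<open>The condition \<open>N < N + c\<close> is \<open>c > 0\<close>, in the form needed for \<open>absorb_variable\<close> with \<open>t = N\<close>.\<close>
  also have "\<dots> = add_strip True (\<lambda>c. if c = 0 then ?y + ?y else ?y)
      (add_strip False (\<lambda>c. if N < N + c then ?y else 0) (colored_gf (\<lambda>k. if k \<le> N then x k else 0) N))"
    by (rule strip_exchange_diagonal) auto
  also have "\<dots> = add_strip True (\<lambda>c. if c = 0 then ?y + ?y else ?y) (colored_gf (\<lambda>k. if k \<le> Suc N then x k else 0) N)"
    by (subst absorb_variable) auto
  also have "(\<lambda>c. if c = 0 then ?y + ?y else ?y) = (\<lambda>c. (\<lambda>k. if k \<le> Suc N then x k else 0) (Suc N) + (\<lambda>k. if k \<le> Suc N then x k else 0) (Suc N + c))"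
    by (auto simp: fun_eq_iff)
  finally show ?case by simp
qed

section \<open>Fillings of a shifted shape as chains of strips\<close>

text \<open>The values are called levels. Equal levels may repeat only along rows if the level is horizontal
(\<open>hor\<close>), and only along columns otherwise, so that the cells of each level form a strip of the
corresponding kind.\<close>

definition fillings :: "(nat \<Rightarrow> bool) \<Rightarrow> nat \<Rightarrow> (nat \<Rightarrow> nat) \<Rightarrow> (nat \<times> nat \<Rightarrow> nat) set" where
  "fillings hor m d = {S \<in> cells d \<rightarrow>\<^sub>E {1..m}.
     (\<forall>i j j'. (i, j) \<in> cells d \<longrightarrow> (i, j') \<in> cells d \<longrightarrow> j < j' \<longrightarrow>
        S (i, j) < S (i, j') \<or> S (i, j) = S (i, j') \<and> hor (S (i, j))) \<and>
     (\<forall>i i' j. (i, j) \<in> cells d \<longrightarrow> (i', j) \<in> cells d \<longrightarrow> i < i' \<longrightarrow>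
        S (i, j) < S (i', j) \<or> S (i, j) = S (i', j) \<and> \<not> hor (S (i, j)))}"

definition filling_gf ::
  "(nat \<Rightarrow> bool) \<Rightarrow> (nat \<Rightarrow> nat \<Rightarrow> 'a::comm_semiring_1) \<Rightarrow> nat \<Rightarrow> (nat \<Rightarrow> nat) \<Rightarrow> 'a" where
  "filling_gf hor w m d = (\<Sum>S\<in>fillings hor m d. \<Prod>(i, j)\<in>cells d. w (S (i, j)) (j - i))"

lemma fillingsD:
  assumes "S \<in> fillings hor m d"
  shows "S \<in> cells d \<rightarrow>\<^sub>E {1..m}"
    and "(i, j) \<in> cells d \<Longrightarrow> (i, j') \<in> cells d \<Longrightarrow> j < j' \<Longrightarrow>
        S (i, j) < S (i, j') \<or> S (i, j) = S (i, j') \<and> hor (S (i, j))"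
    and "(i, j) \<in> cells d \<Longrightarrow> (i', j) \<in> cells d \<Longrightarrow> i < i' \<Longrightarrow>
        S (i, j) < S (i', j) \<or> S (i, j) = S (i', j) \<and> \<not> hor (S (i, j))"
  using assms by (auto simp: fillings_def)

lemma finite_fillings: "profile d \<Longrightarrow> finite (fillings hor m d)"
  by (rule finite_subset[of _ "cells d \<rightarrow>\<^sub>E {1..m}"]) (auto simp: fillings_def intro!: finite_PiE finite_cells)

text \<open>The cells of level at most \<open>m\<close> form a shape, and the cells of level \<open>m + 1\<close> a strip around it: a
violation of the strip inequality would yield two neighbouring cells of level \<open>m + 1\<close> in the
forbidden direction.\<close>

lemma level_set_strip:
  assumes d: "profile d" and S: "S \<in> fillings hor (Suc m) d"
  defines "I \<equiv> {c \<in> cells d. S c \<le> m}"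
  shows "cells (diagonal_profile I) = I" "strip (hor (Suc m)) (diagonal_profile I) d"
proof -
  have range: "S c \<le> Suc m" if "c \<in> cells d" for c
    using fillingsD(1)[OF S] that by (auto simp: PiE_iff)
  have 1: "finite I" using finite_cells[OF d] by (simp add: I_def)
  have 2: "1 \<le> i \<and> i \<le> j" if "(i, j) \<in> I" for i j using that by (auto simp: I_def cells_def)
  have 3: "(i, j) \<in> I" if "(i, Suc j) \<in> I" "i \<le> j" for i j
    using that cells_left[OF d, of i "Suc j" j] fillingsD(2)[OF S, of i j "Suc j"] by (auto simp: I_def)
  have 4: "(i, j) \<in> I" if "(Suc i, j) \<in> I" "1 \<le> i" for i j
    using that cells_above[OF d, of "Suc i" j i] fillingsD(3)[OF S, of i j "Suc i"] by (auto simp: I_def)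
  define \<mu> where "\<mu> = diagonal_profile I"
  have \<mu>: "profile \<mu>" and I: "cells \<mu> = I"
    using order_ideal_profile[OF 1 2 3 4] unfolding \<mu>_def by auto
  have new: "S c = Suc m" if "c \<in> cells d" "c \<notin> cells \<mu>" for c
    using that range[of c] by (auto simp: I I_def)
  have le: "\<mu> c \<le> d c" for c
  proof (rule ccontr)
    assume "\<not> \<mu> c \<le> d c"
    then have "(\<mu> c, \<mu> c + c) \<in> cells \<mu>" "(\<mu> c, \<mu> c + c) \<notin> cells d" by (auto simp: cells_def)
    then show False by (auto simp: I I_def)
  qed
  have "d c \<le> Suc (\<mu> (Suc c))" if h: "hor (Suc m)" for c
  proof (rule ccontr)
    assume n: "\<not> d c \<le> Suc (\<mu> (Suc c))"
    define i where "i = Suc (\<mu> (Suc c))"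
    have a: "(Suc i, Suc i + c) \<in> cells d" using n by (simp add: cells_def i_def)
    have b: "(i, Suc i + c) \<in> cells d" by (rule cells_above[OF d a]) (auto simp: i_def)
    have c: "(i, Suc i + c) \<notin> cells \<mu>" by (simp add: cells_def i_def Suc_diff_le)
    then have c': "(Suc i, Suc i + c) \<notin> cells \<mu>" using cells_above[OF \<mu>, of "Suc i" "Suc i + c" i] by (auto simp: i_def)
    show False using fillingsD(3)[OF S b a] new[OF a c'] new[OF b c] h by simp
  qed
  moreover have "d (Suc c) \<le> \<mu> c" if h: "\<not> hor (Suc m)" for c
  proof (rule ccontr)
    assume n: "\<not> d (Suc c) \<le> \<mu> c"
    define i where "i = Suc (\<mu> c)"
    have a: "(i, i + Suc c) \<in> cells d" using n by (simp add: cells_def i_def)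
    have b: "(i, i + c) \<in> cells d" by (rule cells_left[OF d a]) auto
    have c: "(i, i + c) \<notin> cells \<mu>" by (simp add: cells_def i_def)
    then have c': "(i, i + Suc c) \<notin> cells \<mu>" using cells_left[OF \<mu>, of i "i + Suc c" "i + c"] by auto
    show False using fillingsD(2)[OF S b a] new[OF a c'] new[OF b c] h by simp
  qed
  ultimately show "strip (hor (Suc m)) (diagonal_profile I) d"
    using \<mu> d le by (simp add: strip_def flip: \<mu>_def)
  show "cells (diagonal_profile I) = I" using I by (simp add: \<mu>_def)
qed

lemma extend_filling:
  assumes s: "strip (hor (Suc m)) \<mu> d" and S: "S \<in> fillings hor m \<mu>"
  shows "restrict (\<lambda>c. if c \<in> cells \<mu> then S c else Suc m) (cells d) \<in> fillings hor (Suc m) d"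
    (is "?S \<in> _")
proof -
  note \<mu> = stripD(1)[OF s] and d = stripD(2)[OF s]
  have range: "1 \<le> S c" "S c \<le> m" if "c \<in> cells \<mu>" for c
    using fillingsD(1)[OF S] that by (auto simp: PiE_iff)
  have "?S (i, j) < ?S (i, j') \<or> ?S (i, j) = ?S (i, j') \<and> hor (?S (i, j))"
    if a: "(i, j) \<in> cells d" "(i, j') \<in> cells d" "j < j'" for i j j'
  proof (cases "(i, j') \<in> cells \<mu>")
    case True
    moreover have "(i, j) \<in> cells \<mu>" by (rule cells_left[OF \<mu> True]) (use a in \<open>auto simp: cells_def\<close>)
    ultimately show ?thesis using fillingsD(2)[OF S, of i j j'] a by simp
  next
    case F: False
    show ?thesis
    proof (cases "(i, j) \<in> cells \<mu>")
      case True
      then show ?thesis using F a range(2)[of "(i, j)"] by (simp add: less_Suc_eq_le)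
    next
      case False
      have ij: "1 \<le> i" "i \<le> j" using a by (auto simp: cells_def)
      have "(i, Suc j) \<in> cells d" by (rule cells_left[OF d a(2)]) (use a ij in auto)
      then have "i \<le> d (Suc (j - i))" using ij by (simp add: cells_def Suc_diff_le)
      moreover have "\<not> i \<le> \<mu> (j - i)" using False ij by (simp add: cells_def)
      ultimately have "hor (Suc m)" using stripD(5)[OF s, of "j - i"] by force
      then show ?thesis using False F a by simp
    qed
  qed
  moreover have "?S (i, j) < ?S (i', j) \<or> ?S (i, j) = ?S (i', j) \<and> \<not> hor (?S (i, j))"
    if a: "(i, j) \<in> cells d" "(i', j) \<in> cells d" "i < i'" for i i' j
  proof (cases "(i', j) \<in> cells \<mu>")
    case True
    moreover have "(i, j) \<in> cells \<mu>" by (rule cells_above[OF \<mu> True]) (use a in \<open>auto simp: cells_def\<close>)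
    ultimately show ?thesis using fillingsD(3)[OF S, of i j i'] a by simp
  next
    case F: False
    show ?thesis
    proof (cases "(i, j) \<in> cells \<mu>")
      case True
      then show ?thesis using F a range(2)[of "(i, j)"] by (simp add: less_Suc_eq_le)
    next
      case False
      have ij: "1 \<le> i" "i' \<le> j" using a by (auto simp: cells_def)
      have "(Suc i, j) \<in> cells d" by (rule cells_above[OF d a(2)]) (use a ij in auto)
      then have "Suc i \<le> d (j - Suc i)" by (simp add: cells_def)
      moreover have "Suc (j - Suc i) = j - i" using ij a by simp
      moreover have "\<not> i \<le> \<mu> (j - i)" using False ij a by (simp add: cells_def)
      ultimately have "\<not> hor (Suc m)" using stripD(4)[OF s, of "j - Suc i"] by force
      then show ?thesis using False F a by simp
    qed
  qed
  moreover have "?S \<in> cells d \<rightarrow>\<^sub>E {1..Suc m}" using range(1) le_SucI[OF range(2)] by auto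
  ultimately show ?thesis unfolding fillings_def by blast
qed

text \<open>Splitting off the cells of the highest level is a bijection between fillings and pairs of a strip and
a filling of the remaining shape.\<close>

theorem filling_gf_Suc:
  assumes d: "profile d"
  shows "filling_gf hor w (Suc m) d = add_strip (hor (Suc m)) (w (Suc m)) (filling_gf hor w m) d"
proof -
  let ?I = "\<lambda>S. {c \<in> cells d. S c \<le> m}"
  let ?\<mu> = "\<lambda>S. diagonal_profile (?I S)"
  let ?ext = "\<lambda>\<mu> S. restrict (\<lambda>c. if c \<in> cells \<mu> then S c else Suc m) (cells d)"
  let ?W = "\<lambda>S. \<Prod>(i, j)\<in>cells d. w (S (i, j)) (j - i)"
  have "add_strip (hor (Suc m)) (w (Suc m)) (filling_gf hor w m) d =
      (\<Sum>(\<mu>, S)\<in>Sigma {\<mu>. strip (hor (Suc m)) \<mu> d} (fillings hor m).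
         strip_weight (w (Suc m)) \<mu> d * (\<Prod>(i, j)\<in>cells \<mu>. w (S (i, j)) (j - i)))"
    unfolding add_strip_def filling_gf_def sum_distrib_left
    by (rule sum.Sigma) (auto intro: finite_strips finite_fillings dest: stripD(1))
  also have "\<dots> = (\<Sum>S\<in>fillings hor (Suc m) d. ?W S)"
  proof (rule sum.reindex_bij_witness[where i = "\<lambda>S. (?\<mu> S, restrict S (?I S))" and j = "\<lambda>(\<mu>, S). ?ext \<mu> S"])
    fix a assume "a \<in> Sigma {\<mu>. strip (hor (Suc m)) \<mu> d} (fillings hor m)"
    then obtain \<mu> S where a: "a = (\<mu>, S)" and s: "strip (hor (Suc m)) \<mu> d" and S: "S \<in> fillings hor m \<mu>"
      by blast
    note sub = strip_cells_subset[OF s]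
    have range: "S c \<le> m" if "c \<in> cells \<mu>" for c
      using fillingsD(1)[OF S] that by (auto simp: PiE_iff)
    have I: "?I (?ext \<mu> S) = cells \<mu>" using sub range by (auto simp: subset_iff)
    have "restrict (?ext \<mu> S) (cells \<mu>) = S"
    proof
      fix c show "restrict (?ext \<mu> S) (cells \<mu>) c = S c"
        using sub fillingsD(1)[OF S] by (cases c) (auto simp: restrict_def PiE_iff extensional_def)
    qed
    then show "(?\<mu> (case a of (\<mu>, S) \<Rightarrow> ?ext \<mu> S), restrict (case a of (\<mu>, S) \<Rightarrow> ?ext \<mu> S) (?I (case a of (\<mu>, S) \<Rightarrow> ?ext \<mu> S))) = a"
      unfolding a prod.case I by simp
    show "(case a of (\<mu>, S) \<Rightarrow> ?ext \<mu> S) \<in> fillings hor (Suc m) d"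
      using extend_filling[OF s S] by (simp add: a)
    have "?W (?ext \<mu> S) = (\<Prod>(i, j)\<in>cells d - cells \<mu>. w (?ext \<mu> S (i, j)) (j - i)) * (\<Prod>(i, j)\<in>cells \<mu>. w (?ext \<mu> S (i, j)) (j - i))"
      by (rule prod.subset_diff[OF sub finite_cells[OF d]])
    also have "\<dots> = (\<Prod>(i, j)\<in>cells d - cells \<mu>. w (Suc m) (j - i)) * (\<Prod>(i, j)\<in>cells \<mu>. w (S (i, j)) (j - i))"
      using sub by (intro arg_cong2[where f = times] prod.cong) auto
    finally show "?W (case a of (\<mu>, S) \<Rightarrow> ?ext \<mu> S) =
        (case a of (\<mu>, S) \<Rightarrow> strip_weight (w (Suc m)) \<mu> d * (\<Prod>(i, j)\<in>cells \<mu>. w (S (i, j)) (j - i)))"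
      by (simp add: a prod_cells_strip[OF s])
  next
    fix S assume S: "S \<in> fillings hor (Suc m) d"
    note I = level_set_strip[OF d S]
    have r: "S \<in> cells d \<rightarrow>\<^sub>E {1..Suc m}" by (rule fillingsD(1)[OF S])
    have "?ext (?\<mu> S) (restrict S (?I S)) = S"
    proof
      fix c
      have "c \<notin> cells d \<Longrightarrow> S c = undefined" "c \<in> cells d \<Longrightarrow> S c \<le> Suc m"
        using r by (auto intro: PiE_arb dest: PiE_mem)
      then show "?ext (?\<mu> S) (restrict S (?I S)) c = S c"
        unfolding I(1) by (auto simp: le_Suc_eq)
    qed
    then show "(case (?\<mu> S, restrict S (?I S)) of (\<mu>, S) \<Rightarrow> ?ext \<mu> S) = S" by simp
    have "restrict S (?I S) \<in> fillings hor m (?\<mu> S)"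
    proof -
      have "restrict S (?I S) \<in> ?I S \<rightarrow>\<^sub>E {1..m}" using r by (auto simp: PiE_iff)
      then show ?thesis unfolding fillings_def I(1) using fillingsD(2,3)[OF S] by auto
    qed
    then show "(?\<mu> S, restrict S (?I S)) \<in> Sigma {\<mu>. strip (hor (Suc m)) \<mu> d} (fillings hor m)"
      using I(2) by simp
  qed
  finally show ?thesis by (simp add: filling_gf_def)
qed

lemma filling_gf_0: "filling_gf hor w 0 d = empty_shape d"
proof (cases "cells d = {}")
  case True
  then have "fillings hor 0 d = {\<lambda>_. undefined}" by (auto simp: fillings_def)
  then show ?thesis using True cells_empty_iff[of d] by (simp add: filling_gf_def empty_shape_def)
next
  case False
  then have "fillings hor 0 d = {}" by (auto simp: fillings_def PiE_iff)
  then show ?thesis using False cells_empty_iff[of d] by (auto simp: filling_gf_def empty_shape_def)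
qed

text \<open>The levels \<open>2 k - 1\<close> and \<open>2 k\<close> stand for the letters \<open>k'\<close> and \<open>k\<close>.\<close>

lemma marked_gf_eq_filling_gf:
  "profile d \<Longrightarrow> marked_gf x N d = filling_gf even (\<lambda>l c. x (Suc l div 2)) (2 * N) d"
proof (induction N arbitrary: d)
  case 0
  then show ?case by (simp add: filling_gf_0)
next
  case (Suc N)
  let ?G = "filling_gf even (\<lambda>l c. x (Suc l div 2))"
  have "?G (2 * Suc N) d = add_strip True (\<lambda>_. x (Suc N)) (?G (Suc (2 * N))) d"
    using filling_gf_Suc[OF Suc.prems, of even "\<lambda>l c. x (Suc l div 2)" "Suc (2 * N)"] by simp
  also have "add_strip True (\<lambda>_. x (Suc N)) (?G (Suc (2 * N))) =
      add_strip True (\<lambda>_. x (Suc N)) (add_strip False (\<lambda>_. x (Suc N)) (?G (2 * N)))"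
    by (rule add_strip_cong) (simp add: filling_gf_Suc)
  also have "add_strip False (\<lambda>_. x (Suc N)) (?G (2 * N)) = add_strip False (\<lambda>_. x (Suc N)) (marked_gf x N)"
    by (rule add_strip_cong) (simp add: Suc.IH)
  finally show ?case by simp
qed

lemma colored_gf_eq_filling_gf:
  "profile d \<Longrightarrow> colored_gf x N d = filling_gf (\<lambda>_. True) (\<lambda>t c. x t + x (t + c)) N d"
proof (induction N arbitrary: d)
  case 0
  then show ?case by (simp add: filling_gf_0)
next
  case (Suc N)
  have "add_strip True (\<lambda>c. x (Suc N) + x (Suc N + c)) (colored_gf x N) =
      add_strip True (\<lambda>c. x (Suc N) + x (Suc N + c)) (filling_gf (\<lambda>_. True) (\<lambda>t c. x t + x (t + c)) N)"
    by (rule add_strip_cong) (simp add: Suc.IH)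
  then show ?case using filling_gf_Suc[OF Suc.prems, of "\<lambda>_. True" "\<lambda>t c. x t + x (t + c)" N] by simp
qed

section \<open>Marked shifted tableaux\<close>

lemma shifted_diagram_profile:
  assumes "strict_partition lam n"
  obtains d where "profile d" "cells d = shifted_diagram lam"
proof -
  have "shifted_diagram lam = Sigma {1..length lam} (\<lambda>i. {i..lam ! (i - 1) + i - 1})"
    by (auto simp: shifted_diagram_def)
  then have 1: "finite (shifted_diagram lam)" by simp
  have 2: "1 \<le> i \<and> i \<le> j" if "(i, j) \<in> shifted_diagram lam" for i j
    using that by (simp add: shifted_diagram_def)
  have 3: "(i, j) \<in> shifted_diagram lam" if "(i, Suc j) \<in> shifted_diagram lam" "i \<le> j" for i j
    using that by (simp add: shifted_diagram_def)
  have 4: "(i, j) \<in> shifted_diagram lam" if a: "(Suc i, j) \<in> shifted_diagram lam" "1 \<le> i" for i j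
  proof -
    have "lam ! i < lam ! (i - 1)"
      using assms a sorted_wrt_nth_less[of "(>)" lam "i - 1" i]
      by (simp add: strict_partition_def shifted_diagram_def)
    moreover have "i < length lam" "Suc i \<le> j" "j \<le> lam ! i + i"
      using a by (simp_all add: shifted_diagram_def)
    ultimately have "i \<le> length lam" "i \<le> j" "j \<le> lam ! (i - 1) + i - 1" by linarith+
    then show ?thesis using a(2) by (simp add: shifted_diagram_def)
  qed
  show ?thesis using order_ideal_profile[OF 1 2 3 4] that by blast
qed

text \<open>The order isomorphism from the alphabet to the positive integers.\<close>

fun level :: "letter \<Rightarrow> nat" where
  "level (Marked k) = 2 * k - 1"
| "level (Unmarked k) = 2 * k"

definition letter_of_level :: "nat \<Rightarrow> letter" where
  "letter_of_level l = (if even l then Unmarked (l div 2) else Marked (Suc l div 2))"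

lemma level_letter_of_level [simp]: "level (letter_of_level l) = l"
  by (auto simp: letter_of_level_def elim!: oddE)

lemma letter_of_level_level: "a \<in> alphabet \<Longrightarrow> letter_of_level (level a) = a"
  by (cases a) (auto simp: letter_of_level_def alphabet_def elim!: evenE)

lemma letter_abs_level: "a \<in> alphabet \<Longrightarrow> letter_abs a = Suc (level a) div 2"
  by (cases a) (auto simp: alphabet_def)

lemma is_marked_level: "a \<in> alphabet \<Longrightarrow> is_marked a \<longleftrightarrow> odd (level a)"
  by (cases a) (auto simp: alphabet_def)

lemma level_less_iff: "a \<in> alphabet \<Longrightarrow> b \<in> alphabet \<Longrightarrow> level a < level b \<longleftrightarrow> a < b"
  by (cases a; cases b) (auto simp: alphabet_def less_letter_def)

lemma level_eq_iff: "a \<in> alphabet \<Longrightarrow> b \<in> alphabet \<Longrightarrow> level a = level b \<longleftrightarrow> a = b"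
  by (metis letter_of_level_level)

lemma letter_of_level_alphabet: "1 \<le> l \<Longrightarrow> letter_of_level l \<in> alphabet"
  by (auto simp: letter_of_level_def alphabet_def elim!: evenE)

lemma level_pos: "a \<in> alphabet \<Longrightarrow> 1 \<le> level a"
  by (cases a) (auto simp: alphabet_def)

lemma level_le_iff: "a \<in> alphabet \<Longrightarrow> level a \<le> 2 * N \<longleftrightarrow> letter_abs a \<le> N"
  by (cases a) (auto simp: alphabet_def)

lemma marked_shifted_tableau_iff:
  assumes T: "T \<in> shifted_diagram lam \<rightarrow>\<^sub>E alphabet"
  shows "marked_shifted_tableau lam T \<longleftrightarrow>
     (\<forall>i j j'. (i, j) \<in> shifted_diagram lam \<longrightarrow> (i, j') \<in> shifted_diagram lam \<longrightarrow> j < j' \<longrightarrow>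
        T (i, j) < T (i, j') \<or> T (i, j) = T (i, j') \<and> \<not> is_marked (T (i, j))) \<and>
     (\<forall>i i' j. (i, j) \<in> shifted_diagram lam \<longrightarrow> (i', j) \<in> shifted_diagram lam \<longrightarrow> i < i' \<longrightarrow>
        T (i, j) < T (i', j) \<or> T (i, j) = T (i', j) \<and> is_marked (T (i, j)))"
    (is "_ \<longleftrightarrow> ?row \<and> ?col")
proof
  assume m: "marked_shifted_tableau lam T"
  then have w: "weakly_increasing lam T" by (simp add: marked_shifted_tableau_def)
  show "?row \<and> ?col"
  proof (intro conjI allI impI)
    fix i j j'
    assume c: "(i, j) \<in> shifted_diagram lam" "(i, j') \<in> shifted_diagram lam" "j < j'"
    have "T (i, j) \<le> T (i, j')" using w c unfolding weakly_increasing_def by (meson less_imp_le)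
    moreover have "is_marked (T (i, j)) \<Longrightarrow> is_marked (T (i, j')) \<Longrightarrow> T (i, j) < T (i, j')"
      using m c unfolding marked_shifted_tableau_def by blast
    ultimately show "T (i, j) < T (i, j') \<or> T (i, j) = T (i, j') \<and> \<not> is_marked (T (i, j))"
      by (auto simp: le_less)
  next
    fix i i' j
    assume c: "(i, j) \<in> shifted_diagram lam" "(i', j) \<in> shifted_diagram lam" "i < i'"
    have "T (i, j) \<le> T (i', j)" using w c unfolding weakly_increasing_def by (meson less_imp_le)
    moreover have "\<not> is_marked (T (i, j)) \<Longrightarrow> \<not> is_marked (T (i', j)) \<Longrightarrow> T (i, j) < T (i', j)"
      using m c unfolding marked_shifted_tableau_def by blast
    ultimately show "T (i, j) < T (i', j) \<or> T (i, j) = T (i', j) \<and> is_marked (T (i, j))"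
      unfolding le_less by metis
  qed
next
  assume "?row \<and> ?col"
  then have row: ?row and col: ?col by blast+
  show "marked_shifted_tableau lam T"
    unfolding marked_shifted_tableau_def weakly_increasing_def
  proof (intro conjI allI impI T)
    fix i j j'
    assume c: "(i, j) \<in> shifted_diagram lam" "(i, j') \<in> shifted_diagram lam"
    show "T (i, j) \<le> T (i, j')" if "j \<le> j'"
      using row[rule_format, OF c] that by (cases "j = j'") auto
    show "T (i, j) < T (i, j')" if "j < j'" "is_marked (T (i, j))" "is_marked (T (i, j'))"
      using row[rule_format, OF c] that by blast
  next
    fix i i' j
    assume c: "(i, j) \<in> shifted_diagram lam" "(i', j) \<in> shifted_diagram lam"
    show "T (i, j) \<le> T (i', j)" if "i \<le> i'"
      using col[rule_format, OF c] that by (cases "i = i'") auto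
    show "T (i, j) < T (i', j)" if "i < i'" "\<not> is_marked (T (i, j))" "\<not> is_marked (T (i', j))"
      using col[rule_format, OF c] that by blast
  qed
qed

lemma marked_filling_iff:
  assumes d: "cells d = shifted_diagram lam"
    and T: "T \<in> shifted_diagram lam \<rightarrow>\<^sub>E alphabet"
  shows "marked_shifted_tableau lam T \<and> (\<forall>c\<in>shifted_diagram lam. letter_abs (T c) \<le> N)
    \<longleftrightarrow> restrict (\<lambda>c. level (T c)) (cells d) \<in> fillings even (2 * N) d"
proof -
  have T': "T c \<in> alphabet" if "c \<in> shifted_diagram lam" for c using T that by auto
  have range: "restrict (\<lambda>c. level (T c)) (cells d) \<in> cells d \<rightarrow>\<^sub>E {1..2 * N} \<longleftrightarrow>
      (\<forall>c\<in>shifted_diagram lam. letter_abs (T c) \<le> N)"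
  proof -
    have "level (T c) \<in> {1..2 * N} \<longleftrightarrow> letter_abs (T c) \<le> N" if "c \<in> shifted_diagram lam" for c
      using level_pos[OF T'[OF that]] level_le_iff[OF T'[OF that]] by simp
    then show ?thesis by (simp add: d restrict_PiE_iff Pi_iff)
  qed
  have eqs: "(level (T c) < level (T c') \<or> level (T c) = level (T c') \<and> even (level (T c))) \<longleftrightarrow>
      (T c < T c' \<or> T c = T c' \<and> \<not> is_marked (T c))"
    "(level (T c) < level (T c') \<or> level (T c) = level (T c') \<and> odd (level (T c))) \<longleftrightarrow>
      (T c < T c' \<or> T c = T c' \<and> is_marked (T c))"
    if "c \<in> shifted_diagram lam" "c' \<in> shifted_diagram lam" for c c'
    using T'[OF that(1)] T'[OF that(2)] by (simp_all add: level_less_iff level_eq_iff is_marked_level)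
  let ?S = "restrict (\<lambda>c. level (T c)) (cells d)"
  have rows: "(\<forall>i j j'. (i, j) \<in> cells d \<longrightarrow> (i, j') \<in> cells d \<longrightarrow> j < j' \<longrightarrow>
        ?S (i, j) < ?S (i, j') \<or> ?S (i, j) = ?S (i, j') \<and> even (?S (i, j))) \<longleftrightarrow>
      (\<forall>i j j'. (i, j) \<in> shifted_diagram lam \<longrightarrow> (i, j') \<in> shifted_diagram lam \<longrightarrow> j < j' \<longrightarrow>
        T (i, j) < T (i, j') \<or> T (i, j) = T (i, j') \<and> \<not> is_marked (T (i, j)))"
    unfolding d by (intro iff_allI imp_cong refl) (simp add: eqs)
  have cols: "(\<forall>i i' j. (i, j) \<in> cells d \<longrightarrow> (i', j) \<in> cells d \<longrightarrow> i < i' \<longrightarrow>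
        ?S (i, j) < ?S (i', j) \<or> ?S (i, j) = ?S (i', j) \<and> odd (?S (i, j))) \<longleftrightarrow>
      (\<forall>i i' j. (i, j) \<in> shifted_diagram lam \<longrightarrow> (i', j) \<in> shifted_diagram lam \<longrightarrow> i < i' \<longrightarrow>
        T (i, j) < T (i', j) \<or> T (i, j) = T (i', j) \<and> is_marked (T (i, j)))"
    unfolding d by (intro iff_allI imp_cong refl) (simp add: eqs)
  show ?thesis
    unfolding marked_shifted_tableau_iff[OF T] fillings_def mem_Collect_eq rows cols range
    by (rule conj_commute)
qed

lemma marked_tableaux_gf:
  fixes x :: "nat \<Rightarrow> 'a::comm_semiring_1"
  assumes d: "profile d" "cells d = shifted_diagram lam"
  shows "(\<Sum>T | marked_shifted_tableau lam T \<and> (\<forall>c\<in>shifted_diagram lam. letter_abs (T c) \<le> N).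
      \<Prod>c\<in>shifted_diagram lam. x (letter_abs (T c))) = marked_gf x N d"
  unfolding marked_gf_eq_filling_gf[OF d(1)] filling_gf_def d(2)[symmetric]
proof (rule sum.reindex_bij_witness[where i = "\<lambda>S. restrict (\<lambda>c. letter_of_level (S c)) (cells d)"
      and j = "\<lambda>T. restrict (\<lambda>c. level (T c)) (cells d)"])
  fix T assume T: "T \<in> {T. marked_shifted_tableau lam T \<and> (\<forall>c\<in>cells d. letter_abs (T c) \<le> N)}"
  then have TE: "T \<in> shifted_diagram lam \<rightarrow>\<^sub>E alphabet" by (simp add: marked_shifted_tableau_def)
  then have T': "T c \<in> alphabet" if "c \<in> cells d" for c using that d(2) by auto
  show "restrict (\<lambda>c. level (T c)) (cells d) \<in> fillings even (2 * N) d"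
    using T marked_filling_iff[OF d(2) TE, of N] by (simp add: d(2))
  show "restrict (\<lambda>c. letter_of_level (restrict (\<lambda>c. level (T c)) (cells d) c)) (cells d) = T"
  proof
    fix c show "restrict (\<lambda>c. letter_of_level (restrict (\<lambda>c. level (T c)) (cells d) c)) (cells d) c = T c"
      using T'[of c] PiE_arb[OF TE, of c] d(2) by (auto simp: letter_of_level_level)
  qed
  show "(\<Prod>(i, j)\<in>cells d. x (Suc (restrict (\<lambda>c. level (T c)) (cells d) (i, j)) div 2)) =
      (\<Prod>c\<in>cells d. x (letter_abs (T c)))"
    using T' by (intro prod.cong refl) (auto simp: letter_abs_level)
next
  fix S assume S: "S \<in> fillings even (2 * N) d"
  let ?T = "restrict (\<lambda>c. letter_of_level (S c)) (cells d)"
  have SE: "S \<in> cells d \<rightarrow>\<^sub>E {1..2 * N}" by (rule fillingsD(1)[OF S])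
  have "letter_of_level (S c) \<in> alphabet" if "c \<in> cells d" for c
    using PiE_mem[OF SE that] by (simp add: letter_of_level_alphabet)
  then have TE: "?T \<in> shifted_diagram lam \<rightarrow>\<^sub>E alphabet"
    by (simp add: d(2)[symmetric] restrict_PiE_iff)
  have eq: "restrict (\<lambda>c. level (?T c)) (cells d) = S"
  proof
    fix c show "restrict (\<lambda>c. level (?T c)) (cells d) c = S c"
      using PiE_arb[OF SE, of c] by auto
  qed
  then show "restrict (\<lambda>c. level (?T c)) (cells d) = S" .
  show "?T \<in> {T. marked_shifted_tableau lam T \<and> (\<forall>c\<in>cells d. letter_abs (T c) \<le> N)}"
    using S marked_filling_iff[OF d(2) TE, of N] unfolding eq by (simp add: d(2))
qed

section \<open>Colored shifted tableaux\<close>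

text \<open>The filling \<open>S\<close> underlying a colored tableau \<open>C\<close>, that is, \<open>color_bar C (i, j) + i\<close>. It does not
determine \<open>C\<close>: for each cell, the letter may be marked or not, which gives the set \<open>colorings\<close>.\<close>

definition base_filling :: "nat list \<Rightarrow> (nat \<times> nat \<Rightarrow> letter) \<Rightarrow> nat \<times> nat \<Rightarrow> nat" where
  "base_filling lam C = (\<lambda>(i, j)\<in>shifted_diagram lam.
     if is_marked (C (i, j)) then letter_abs (C (i, j)) - (j - i) else letter_abs (C (i, j)))"

definition colorings :: "nat list \<Rightarrow> (nat \<times> nat \<Rightarrow> nat) \<Rightarrow> (nat \<times> nat \<Rightarrow> letter) set" where
  "colorings lam S = (\<Pi>\<^sub>E (i, j)\<in>shifted_diagram lam. {Marked (S (i, j) + (j - i)), Unmarked (S (i, j))})"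

lemma color_bar_colorings:
  assumes "C \<in> colorings lam S" "(i, j) \<in> shifted_diagram lam"
  shows "color_bar C (i, j) = int (S (i, j)) - int i"
proof -
  have "C (i, j) \<in> {Marked (S (i, j) + (j - i)), Unmarked (S (i, j))}"
    using assms PiE_mem unfolding colorings_def by fastforce
  moreover have "i \<le> j" using assms(2) by (simp add: shifted_diagram_def)
  ultimately show ?thesis by (auto simp: color_bar_def)
qed

lemma base_filling_colorings:
  assumes "C \<in> colorings lam S" "S \<in> extensional (shifted_diagram lam)"
  shows "base_filling lam C = S"
proof
  fix c :: "nat \<times> nat"
  obtain i j where c: "c = (i, j)" by (cases c)
  show "base_filling lam C c = S c"
  proof (cases "(i, j) \<in> shifted_diagram lam")
    case True
    then have "C (i, j) \<in> {Marked (S (i, j) + (j - i)), Unmarked (S (i, j))}"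
      using assms(1) PiE_mem unfolding colorings_def by fastforce
    then show ?thesis using True by (auto simp: base_filling_def c)
  next
    case False
    then show ?thesis using assms(2) by (auto simp: base_filling_def c extensional_def)
  qed
qed

text \<open>A column of a shape has no gaps, and strictly increasing integers grow by at least 1 in each step.\<close>

lemma column_strict_iff_shifted:
  fixes S :: "nat \<times> nat \<Rightarrow> nat"
  assumes d: "profile d"
  shows "(\<forall>i i' j. (i, j) \<in> cells d \<longrightarrow> (i', j) \<in> cells d \<longrightarrow> i < i' \<longrightarrow> S (i, j) < S (i', j)) \<longleftrightarrow>
    (\<forall>i i' j. (i, j) \<in> cells d \<longrightarrow> (i', j) \<in> cells d \<longrightarrow> i \<le> i' \<longrightarrow> int (S (i, j)) - int i \<le> int (S (i', j)) - int i')"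
proof (intro iffI allI impI)
  fix i i' j
  assume strict: "\<forall>i i' j. (i, j) \<in> cells d \<longrightarrow> (i', j) \<in> cells d \<longrightarrow> i < i' \<longrightarrow> S (i, j) < S (i', j)"
    and a: "(i, j) \<in> cells d" "(i', j) \<in> cells d" "i \<le> i'"
  show "int (S (i, j)) - int i \<le> int (S (i', j)) - int i'"
    using a(3,2)
  proof (induction i' rule: dec_induct)
    case (step k)
    have "(k, j) \<in> cells d"
      by (rule cells_above[OF d step.prems]) (use a(1) step.hyps in \<open>auto simp: cells_def\<close>)
    then show ?case using step strict[rule_format, of k j "Suc k"] by simp
  qed simp
next
  fix i i' j
  assume "\<forall>i i' j. (i, j) \<in> cells d \<longrightarrow> (i', j) \<in> cells d \<longrightarrow> i \<le> i' \<longrightarrow> int (S (i, j)) - int i \<le> int (S (i', j)) - int i'"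
    and "(i, j) \<in> cells d" "(i', j) \<in> cells d" "i < i'"
  then show "S (i, j) < S (i', j)" by fastforce
qed

text \<open>Subtracting the row index turns columns that increase strictly into columns that increase weakly and
does not affect rows. The entries of \<open>S\<close> are positive if and only if those of \<open>color_bar C\<close> are
nonnegative, since every column of a shifted shape starts in row 1.\<close>

lemma colored_filling_iff:
  assumes d: "profile d" "cells d = shifted_diagram lam"
    and C: "C \<in> colorings lam S" and S: "S \<in> extensional (shifted_diagram lam)"
  shows "colored_shifted_tableau lam C \<and> (\<forall>c\<in>shifted_diagram lam. S c \<le> N)
    \<longleftrightarrow> S \<in> fillings (\<lambda>_. True) N d"
proof -
  let ?Y = "shifted_diagram lam"
  have CE: "C c \<in> {Marked (S c + (snd c - fst c)), Unmarked (S c)}" if "c \<in> ?Y" for c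
    using C that PiE_mem unfolding colorings_def by (cases c) fastforce
  have undef: "C c = undefined" if "c \<notin> ?Y" for c
    using C that unfolding colorings_def by (rule PiE_arb)
  have alph: "C \<in> ?Y \<rightarrow>\<^sub>E alphabet" if "\<forall>c\<in>?Y. 1 \<le> S c"
  proof (rule PiE_I)
    fix c assume "c \<in> ?Y"
    then show "C c \<in> alphabet" using CE[of c] that by (fastforce simp: alphabet_def)
  qed (rule undef)
  have bar: "color_bar C (i, j) = int (S (i, j)) - int i" if "(i, j) \<in> ?Y" for i j
    by (rule color_bar_colorings[OF C that])
  define rows where "rows \<longleftrightarrow> (\<forall>i j j'. (i, j) \<in> ?Y \<longrightarrow> (i, j') \<in> ?Y \<longrightarrow> j < j' \<longrightarrow> S (i, j) \<le> S (i, j'))"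
  define cols where "cols \<longleftrightarrow> (\<forall>i i' j. (i, j) \<in> ?Y \<longrightarrow> (i', j) \<in> ?Y \<longrightarrow> i < i' \<longrightarrow> S (i, j) < S (i', j))"
  have inc: "weakly_increasing lam (color_bar C) \<longleftrightarrow> rows \<and> cols"
  proof -
    have "rows \<longleftrightarrow> (\<forall>i j j'. (i, j) \<in> ?Y \<longrightarrow> (i, j') \<in> ?Y \<longrightarrow> j \<le> j' \<longrightarrow> color_bar C (i, j) \<le> color_bar C (i, j'))"
      unfolding rows_def by (auto simp: bar le_less)
    moreover have "cols \<longleftrightarrow> (\<forall>i i' j. (i, j) \<in> ?Y \<longrightarrow> (i', j) \<in> ?Y \<longrightarrow> i \<le> i' \<longrightarrow> color_bar C (i, j) \<le> color_bar C (i', j))"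
      unfolding cols_def column_strict_iff_shifted[OF d(1), unfolded d(2)] by (auto simp: bar)
    ultimately show ?thesis by (simp add: weakly_increasing_def)
  qed
  have nonneg: "(\<forall>c\<in>?Y. 0 \<le> color_bar C c) \<longleftrightarrow> (\<forall>c\<in>?Y. 1 \<le> S c)" if cols
  proof
    assume *: "\<forall>c\<in>?Y. 0 \<le> color_bar C c"
    show "\<forall>c\<in>?Y. 1 \<le> S c"
    proof
      fix c assume c: "c \<in> ?Y"
      obtain i j where ij: "c = (i, j)" by (cases c)
      have "1 \<le> i" using c by (simp add: ij shifted_diagram_def)
      then show "1 \<le> S c" using * c bar[of i j] by (auto simp: ij)
    qed
  next
    assume *: "\<forall>c\<in>?Y. 1 \<le> S c"
    show "\<forall>c\<in>?Y. 0 \<le> color_bar C c"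
    proof
      fix c assume c: "c \<in> ?Y"
      obtain i j where ij: "c = (i, j)" by (cases c)
      have i: "1 \<le> i" using c by (simp add: ij shifted_diagram_def)
      have top: "(1, j) \<in> ?Y" using cells_above[OF d(1), of i j 1] c i by (simp add: ij d(2))
      have "int (S (1, j)) - int 1 \<le> int (S (i, j)) - int i"
        using that column_strict_iff_shifted[OF d(1), of S] c top i unfolding cols_def d(2) ij by blast
      then show "0 \<le> color_bar C c" using * top bar[of i j] c by (force simp: ij)
    qed
  qed
  have "S \<in> fillings (\<lambda>_. True) N d \<longleftrightarrow> (\<forall>c\<in>?Y. 1 \<le> S c \<and> S c \<le> N) \<and> rows \<and> cols"
    using S by (auto simp: fillings_def d(2) PiE_iff rows_def cols_def le_less)
  then show ?thesis
    unfolding colored_shifted_tableau_def shifted_reverse_plane_tableau_def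
    using inc nonneg alph by blast
qed

lemma colored_in_colorings:
  assumes "colored_shifted_tableau lam C"
  shows "C \<in> colorings lam (base_filling lam C)"
  unfolding colorings_def
proof (rule PiE_I)
  fix c assume c: "c \<in> shifted_diagram lam"
  obtain i j where ij: "c = (i, j)" by (cases c)
  have "0 \<le> color_bar C (i, j)"
    using assms c by (auto simp: ij colored_shifted_tableau_def shifted_reverse_plane_tableau_def)
  then show "C c \<in> (case c of (i, j) \<Rightarrow> {Marked (base_filling lam C (i, j) + (j - i)), Unmarked (base_filling lam C (i, j))})"
    using c by (cases "C (i, j)") (auto simp: ij base_filling_def color_bar_def)
qed (use assms in \<open>auto simp: colored_shifted_tableau_def\<close>)

lemma base_filling_extensional: "base_filling lam C \<in> extensional (shifted_diagram lam)"
  by (auto simp: base_filling_def)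

text \<open>Summing over all colorings of a fixed filling produces the weights \<open>x\<^sub>t + x\<^bsub>t+c\<^esub>\<close>. The restriction is on the
levels of the filling and not on the letters, which can exceed \<open>N\<close>.\<close>

lemma colored_tableaux_gf:
  fixes x :: "nat \<Rightarrow> 'a::comm_semiring_1"
  assumes d: "profile d" "cells d = shifted_diagram lam"
  shows "(\<Sum>C | colored_shifted_tableau lam C \<and> (\<forall>c\<in>shifted_diagram lam. base_filling lam C c \<le> N).
      \<Prod>c\<in>shifted_diagram lam. x (letter_abs (C c))) = colored_gf x N d"
proof -
  let ?Y = "shifted_diagram lam" and ?F = "fillings (\<lambda>_. True) N d"
  have fin: "finite ?Y" using finite_cells[OF d(1)] by (simp add: d(2))
  have ext: "S \<in> extensional ?Y" if "S \<in> ?F" for S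
    using fillingsD(1)[OF that] by (auto simp: d(2) PiE_iff)
  have "colored_gf x N d = (\<Sum>S\<in>?F. \<Prod>c\<in>?Y. \<Sum>a\<in>(case c of (i, j) \<Rightarrow> {Marked (S (i, j) + (j - i)), Unmarked (S (i, j))}). x (letter_abs a))"
    unfolding colored_gf_eq_filling_gf[OF d(1)] filling_gf_def d(2)
    by (intro sum.cong prod.cong refl) (auto simp: add.commute)
  also have "\<dots> = (\<Sum>S\<in>?F. \<Sum>C\<in>colorings lam S. \<Prod>c\<in>?Y. x (letter_abs (C c)))"
    unfolding colorings_def by (intro sum.cong refl prod_sum_PiE fin) auto
  also have "\<dots> = (\<Sum>(S, C)\<in>Sigma ?F (colorings lam). \<Prod>c\<in>?Y. x (letter_abs (C c)))"
    by (rule sum.Sigma) (auto simp: colorings_def intro!: finite_fillings d finite_PiE fin)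
  also have "\<dots> = (\<Sum>C | colored_shifted_tableau lam C \<and> (\<forall>c\<in>?Y. base_filling lam C c \<le> N).
      \<Prod>c\<in>?Y. x (letter_abs (C c)))"
  proof (rule sum.reindex_bij_witness[where j = snd and i = "\<lambda>C. (base_filling lam C, C)"])
    fix a assume "a \<in> Sigma ?F (colorings lam)"
    then obtain S C where a: "a = (S, C)" and S: "S \<in> ?F" and C: "C \<in> colorings lam S" by blast
    have eq: "base_filling lam C = S" by (rule base_filling_colorings[OF C ext[OF S]])
    then show "(base_filling lam (snd a), snd a) = a" by (simp add: a)
    show "snd a \<in> {C. colored_shifted_tableau lam C \<and> (\<forall>c\<in>?Y. base_filling lam C c \<le> N)}"
      using colored_filling_iff[OF d C ext[OF S], of N] S by (simp add: a eq)
  next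
    fix C assume C: "C \<in> {C. colored_shifted_tableau lam C \<and> (\<forall>c\<in>?Y. base_filling lam C c \<le> N)}"
    then have C': "C \<in> colorings lam (base_filling lam C)" by (simp add: colored_in_colorings)
    then show "(base_filling lam C, C) \<in> Sigma ?F (colorings lam)"
      using colored_filling_iff[OF d C' base_filling_extensional, of N] C by simp
  qed auto
  finally show ?thesis ..
qed

section \<open>Comparing coefficients\<close>

text \<open>The variable \<open>x\<^sub>k\<close> of a polynomial ring with natural coefficients, a polynomial being a finitely
supported function on exponent vectors. The variables beyond \<open>N\<close> are set to 0.\<close>

definition variable :: "nat \<Rightarrow> nat \<Rightarrow> (nat \<Rightarrow>\<^sub>0 nat) \<Rightarrow>\<^sub>0 nat" where
  "variable N k = (if k \<le> N then Poly_Mapping.single (Poly_Mapping.single k 1) 1 else 0)"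

lemma prod_variable:
  assumes "finite Y"
  shows "(\<Prod>c\<in>Y. variable N (f c)) = (if \<forall>c\<in>Y. f c \<le> N
     then Poly_Mapping.single (\<Sum>c\<in>Y. Poly_Mapping.single (f c) 1) 1 else 0)"
  using assms
proof (induction Y rule: finite_induct)
  case empty
  show ?case by (simp flip: single_one)
qed (auto simp: variable_def mult_single)

lemma lookup_sum_single:
  assumes "finite Y"
  shows "Poly_Mapping.lookup (\<Sum>c\<in>Y. Poly_Mapping.single (f c) 1) k = card {c \<in> Y. f c = k}"
proof -
  have "Poly_Mapping.lookup (\<Sum>c\<in>Y. Poly_Mapping.single (f c) 1) k = (\<Sum>c\<in>Y. if f c = k then 1 else 0)"
    by (simp add: lookup_sum lookup_single when_def)
  also have "\<dots> = card {c \<in> Y. f c = k}"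
    using assms by (simp add: sum.inter_filter[symmetric])
  finally show ?thesis .
qed

lemma coefficient_eq_card:
  fixes \<beta> :: "nat \<Rightarrow>\<^sub>0 nat"
  assumes Y: "finite Y" and fin: "finite A"
  shows "Poly_Mapping.lookup (\<Sum>T\<in>A. \<Prod>c\<in>Y. variable N (f T c)) \<beta> =
    card {T \<in> A. (\<forall>c\<in>Y. f T c \<le> N) \<and> (\<forall>k. card {c \<in> Y. f T c = k} = Poly_Mapping.lookup \<beta> k)}"
proof -
  have "Poly_Mapping.lookup (\<Prod>c\<in>Y. variable N (f T c)) \<beta> =
      (if (\<forall>c\<in>Y. f T c \<le> N) \<and> (\<forall>k. card {c \<in> Y. f T c = k} = Poly_Mapping.lookup \<beta> k) then 1 else 0)" for T
  proof -
    have "(\<Sum>c\<in>Y. Poly_Mapping.single (f T c) 1) = \<beta> \<longleftrightarrow> (\<forall>k. card {c \<in> Y. f T c = k} = Poly_Mapping.lookup \<beta> k)"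
      using lookup_sum_single[OF Y, of "f T"] by (simp add: poly_mapping_eq_iff fun_eq_iff)
    then show ?thesis by (simp add: prod_variable[OF Y] lookup_single when_def)
  qed
  then show ?thesis using fin by (simp add: lookup_sum sum.inter_filter[symmetric])
qed

theorem theorem2p2:
  fixes lam :: "nat list" and \<alpha> :: "nat \<Rightarrow> nat" and n :: nat
  assumes "strict_partition lam n"
    and "composition \<alpha> n"
  shows "\<exists>f. bij_betw f
    {T. marked_shifted_tableau lam T \<and> has_weight lam T \<alpha>}
    {C. colored_shifted_tableau lam C \<and> has_weight lam C \<alpha>}"
proof -
  let ?Y = "shifted_diagram lam"
  obtain d where d: "profile d" "cells d = ?Y"
    using assms(1) by (rule shifted_diagram_profile)
  have finY: "finite ?Y" using finite_cells[OF d(1)] by (simp add: d(2))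
  obtain N where N: "\<alpha> k = 0" if "k > N" for k
  proof -
    have "finite {k. 1 \<le> k \<and> \<alpha> k \<noteq> 0}" using assms(2) by (simp add: composition_def)
    then obtain N where N: "\<forall>k\<in>{k. 1 \<le> k \<and> \<alpha> k \<noteq> 0}. k \<le> N"
      using finite_nat_set_iff_bounded_le by blast
    have "\<alpha> k = 0" if "k > N" for k
    proof (rule ccontr)
      assume "\<alpha> k \<noteq> 0"
      then have "k \<in> {k. 1 \<le> k \<and> \<alpha> k \<noteq> 0}" using that by simp
      then show False using N that by (metis not_le)
    qed
    then show thesis by (rule that)
  qed
  define \<beta> where "\<beta> = (\<Sum>k\<in>{1..N}. Poly_Mapping.single k (\<alpha> k))"
  have \<beta>: "Poly_Mapping.lookup \<beta> k = (if k = 0 then 0 else \<alpha> k)" for k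
  proof -
    have "Poly_Mapping.lookup \<beta> k = (if k \<in> {1..N} then \<alpha> k else 0)"
      by (simp add: \<beta>_def lookup_sum lookup_single when_def)
    then show ?thesis using N[of k] by auto
  qed
  \<comment> \<open>The right-hand side depends on the exponent vector of \<open>T\<close> only; its entry 0 vanishes because the alphabet starts at 1.\<close>
  have weight: "has_weight lam T \<alpha> \<longleftrightarrow>
      (\<forall>c\<in>?Y. letter_abs (T c) \<le> N) \<and> (\<forall>k. card {c \<in> ?Y. letter_abs (T c) = k} = Poly_Mapping.lookup \<beta> k)"
    if T: "T \<in> ?Y \<rightarrow>\<^sub>E alphabet" for T
  proof -
    have "{c \<in> ?Y. letter_abs (T c) = 0} = {}" using T by (force simp: alphabet_def)
    then have 0: "card {c \<in> ?Y. letter_abs (T c) = 0} = 0" by (simp only: card.empty)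
    have *: "has_weight lam T \<alpha> \<longleftrightarrow> (\<forall>k. card {c \<in> ?Y. letter_abs (T c) = k} = Poly_Mapping.lookup \<beta> k)"
      (is "_ \<longleftrightarrow> (\<forall>k. ?eq k)")
    proof (intro iffI allI)
      fix k
      assume "has_weight lam T \<alpha>"
      then show "?eq k"
        using 0 by (cases "k = 0") (simp_all add: has_weight_def weight_def \<beta> del: card_0_eq)
    next
      assume "\<forall>k. ?eq k"
      then show "has_weight lam T \<alpha>" by (simp add: has_weight_def weight_def \<beta>)
    qed
    have "letter_abs (T c) \<le> N" if "has_weight lam T \<alpha>" "c \<in> ?Y" for c
    proof (rule ccontr)
      assume "\<not> letter_abs (T c) \<le> N"
      then have "card {c' \<in> ?Y. letter_abs (T c') = letter_abs (T c)} = 0"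
        using that(1) N by (simp add: has_weight_def weight_def)
      then have "{c' \<in> ?Y. letter_abs (T c') = letter_abs (T c)} = {}" using finY by (simp only: card_eq_0_iff) simp
      then show False using that(2) by blast
    qed
    then show ?thesis using * by blast
  qed
  define M where "M = {T. marked_shifted_tableau lam T \<and> (\<forall>c\<in>?Y. letter_abs (T c) \<le> N)}"
  define K where "K = {C. colored_shifted_tableau lam C \<and> (\<forall>c\<in>?Y. base_filling lam C c \<le> N)}"
  have bounded: "finite {T \<in> ?Y \<rightarrow>\<^sub>E alphabet. \<forall>c\<in>?Y. letter_abs (T c) \<le> m}" for m
  proof -
    have "{a. letter_abs a \<le> m} \<subseteq> Marked ` {..m} \<union> Unmarked ` {..m}"
    proof
      fix a assume "a \<in> {a. letter_abs a \<le> m}"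
      then show "a \<in> Marked ` {..m} \<union> Unmarked ` {..m}" by (cases a) auto
    qed
    then have "finite {a. letter_abs a \<le> m}" by (rule finite_subset) simp
    then show ?thesis
      by (intro finite_subset[OF _ finite_PiE[OF finY, of "\<lambda>_. {a. letter_abs a \<le> m}"]]) (auto simp: PiE_iff extensional_def)
  qed
  have finM: "finite M"
    by (rule finite_subset[OF _ bounded[of N]]) (auto simp: M_def marked_shifted_tableau_def)
  have finK: "finite K"
  proof (rule finite_subset)
    show "K \<subseteq> (\<Union>S\<in>fillings (\<lambda>_. True) N d. colorings lam S)"
    proof
      fix C assume C: "C \<in> K"
      then have C': "C \<in> colorings lam (base_filling lam C)" by (simp add: K_def colored_in_colorings)
      moreover have "base_filling lam C \<in> fillings (\<lambda>_. True) N d"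
        using colored_filling_iff[OF d C' base_filling_extensional, of N] C by (simp add: K_def)
      ultimately show "C \<in> (\<Union>S\<in>fillings (\<lambda>_. True) N d. colorings lam S)" by blast
    qed
    show "finite (\<Union>S\<in>fillings (\<lambda>_. True) N d. colorings lam S)"
      by (auto simp: colorings_def intro!: finite_fillings d finite_PiE finY)
  qed
  have marked: "{T. marked_shifted_tableau lam T \<and> has_weight lam T \<alpha>} =
      {T \<in> M. (\<forall>c\<in>?Y. letter_abs (T c) \<le> N) \<and> (\<forall>k. card {c \<in> ?Y. letter_abs (T c) = k} = Poly_Mapping.lookup \<beta> k)}"
    using weight by (auto simp: M_def marked_shifted_tableau_def)
  have "base_filling lam C c \<le> letter_abs (C c)" if "c \<in> ?Y" for C c
    using that by (cases c) (auto simp: base_filling_def)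
  then have colored: "{C. colored_shifted_tableau lam C \<and> has_weight lam C \<alpha>} =
      {C \<in> K. (\<forall>c\<in>?Y. letter_abs (C c) \<le> N) \<and> (\<forall>k. card {c \<in> ?Y. letter_abs (C c) = k} = Poly_Mapping.lookup \<beta> k)}"
    using weight by (fastforce simp: K_def colored_shifted_tableau_def intro: order_trans)
  have "(\<lambda>k. if k \<le> N then variable N k else 0) = variable N" by (auto simp: variable_def)
  then have "marked_gf (variable N) N d = colored_gf (variable N) N d"
    using marked_gf_eq_colored_gf[of "variable N" N] by simp
  then have "(\<Sum>T\<in>M. \<Prod>c\<in>?Y. variable N (letter_abs (T c))) = (\<Sum>C\<in>K. \<Prod>c\<in>?Y. variable N (letter_abs (C c)))"
    unfolding M_def K_def marked_tableaux_gf[OF d] colored_tableaux_gf[OF d] .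
  then have "card {T. marked_shifted_tableau lam T \<and> has_weight lam T \<alpha>} =
      card {C. colored_shifted_tableau lam C \<and> has_weight lam C \<alpha>}"
    unfolding marked colored coefficient_eq_card[OF finY finM, symmetric]
      coefficient_eq_card[OF finY finK, symmetric] by (rule arg_cong)
  moreover have "finite {T. marked_shifted_tableau lam T \<and> has_weight lam T \<alpha>}"
    unfolding marked using finM by simp
  moreover have "finite {C. colored_shifted_tableau lam C \<and> has_weight lam C \<alpha>}"
    unfolding colored using finK by simp
  ultimately show ?thesis by (rule finite_same_card_bij[rotated 2])
qed

end
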